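(* Let the setting and assumptions of the context hold, and assume that $F$ is smooth in the classical sense: there is $\mathcal{L}>0$ with $\|\nabla F(\theta)-\nabla F(\theta')\|\le\mathcal{L}\|\theta-\theta'\|$ for all $\theta,\theta'\in\mathbb{R}^d$. Let $\Delta=F(\theta_0)-F^\star$. Then, for a suitable choice of its step size $\eta>0$, FO-B-MAML using SGD started at $\theta_0$ finds a meta-parameter $\theta$ (one of its iterates) satisfying $\mathbb{E}[\|\nabla F(\theta)\|]\le\varepsilon+b$ in $$\mathcal{O}\Big(\frac{\mathcal{L}\Delta}{\varepsilon^2}+\frac{\mathcal{L}\Delta\,\tilde\sigma^2}{\varepsilon^4}\Big)$$ outer steps, where $b$ is the estimator bias: $b=\mathcal{O}(\lambda\sqrt{\delta})$ if the forward approximation is used with $\nu\sim\delta^{1/2}$, and $b=\mathcal{O}(\lambda\delta^{2/3})$ if the symmetric approximation is used with $\nu\sim\delta^{1/3}$.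
   Context: Tasks and objective. There are $M$ training tasks. Task $i$ has a training objective $\hat f_i:\mathbb{R}^d\to\mathbb{R}$ and a test objective $f_i:\mathbb{R}^d\to\mathbb{R}$. Let $\lambda>0$ and let $\|\cdot\|$ be the Euclidean norm. For $\nu\in\mathbb{R}$ near $0$ let $\phi^\star_{i,\nu}(\theta)=\arg\min_{\phi\in\mathbb{R}^d}\nu f_i(\phi)+\hat f_i(\phi)+\frac{\lambda}{2}\|\phi-\theta\|^2$ (uniquely defined for $|\nu|<\mu/L_1$ under the assumptions below). Put $F_i(\theta)=f_i(\phi^\star_{i,0}(\theta))$ and $F=\frac1M\sum_{i=1}^M F_i$; $F^\star$ is the global minimum value of $F$. Assumptions, for every $i$: $\hat f_i$ is twice differentiable with $\hat L_1$-Lipschitz gradient and $\hat L_2$-Lipschitz Hessian; $f_i$ is differentiable, $L_0$-Lipschitz, with $L_1$-Lipschitz gradient; $\hat f_i+\frac{\lambda}{2}\|\cdot\|^2$ is $\mu$-strongly convex with $\mu>0$. When the symmetric approximation is used, additionally: $\hat f_i$ is $C^4$ with $\hat L_3$-Lipschitz third derivative, and $f_i$ is $C^3$ with $L_2$-Lipschitz second derivative. Task similarity: $\frac1M\sum_{i=1}^M\|\nabla F_i(\theta)-\nabla F(\theta)\|^2\le\zeta^2$ for all $\theta$. Algorithm (FO-B-MAML using SGD). At each outer step $t$, draw a mini-batch of $B\le M$ distinct tasks uniformly at random. For each drawn task $i$ an inner solver returns points $\tilde\phi_{i,\nu'}(\theta_t)$ with $\|\tilde\phi_{i,\nu'}(\theta_t)-\phi^\star_{i,\nu'}(\theta_t)\|\le\delta$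 for the needed values $\nu'$. Set $g_i=-\lambda\frac{\tilde\phi_{i,\nu}(\theta_t)-\tilde\phi_{i,0}(\theta_t)}{\nu}$ (forward approximation) or $g_i=-\lambda\frac{\tilde\phi_{i,\nu}(\theta_t)-\tilde\phi_{i,-\nu}(\theta_t)}{2\nu}$ (symmetric approximation). Let $\hat g_t$ be the average of $g_i$ over the mini-batch, and update $\theta_{t+1}=\theta_t-\eta\,\hat g_t$. The outer variance from task sampling is $\tilde\sigma^2:=\frac{M-B}{MB}\zeta^2$. Conventions. In the step count, $\mathcal{O}$ hides a universal constant and is understood for all sufficiently small $\varepsilon>0$ (the threshold may depend on the problem parameters). In the expressions for $b$, $\mathcal{O}$ is understood as $\delta\to0^+$, with implied constant depending only on $\lambda,\mu,L_0,L_1,L_2,\hat L_1,\hat L_2,\hat L_3$ and the constants in $\nu\sim\delta^{1/2}$ (resp. $\nu\sim\delta^{1/3}$), not on $\varepsilon$. *)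

theory Defs
  imports "HOL-Probability.Probability"
begin

definition grad :: "('a::real_inner \<Rightarrow> real) \<Rightarrow> 'a \<Rightarrow> 'a" where
  "grad f x = (THE D. GDERIV f x :> D)"

text \<open>The Frechet derivative as a bounded linear map, so that iterating it yields the higher
  derivatives together with their operator norms. The Hessian of \<open>f\<close> is \<open>fderiv (grad f)\<close>, its
  third derivative is \<open>fderiv (fderiv (grad f))\<close>; via the inner product these are isometric to
  the usual multilinear forms.\<close>

definition fderiv ::
  "('a::real_normed_vector \<Rightarrow> 'b::real_normed_vector) \<Rightarrow> 'a \<Rightarrow> 'a \<Rightarrow>\<^sub>L 'b" where
  "fderiv f x = Blinfun (frechet_derivative f (at x))"

definition strongly_convex :: "real \<Rightarrow> ('a::real_inner \<Rightarrow> real) \<Rightarrow> bool" where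
  "strongly_convex mu h \<longleftrightarrow>
     (\<forall>x y. \<forall>t\<in>{0..1}. h ((1 - t) *\<^sub>R x + t *\<^sub>R y)
        \<le> (1 - t) * h x + t * h y - mu / 2 * t * (1 - t) * (norm (x - y))\<^sup>2)"

definition phi_star ::
  "('a::real_inner \<Rightarrow> real) \<Rightarrow> ('a \<Rightarrow> real) \<Rightarrow> real \<Rightarrow> real \<Rightarrow> 'a \<Rightarrow> 'a" where
  "phi_star f fh lam nu \<theta> =
     (ARG_MIN (\<lambda>\<phi>. nu * f \<phi> + fh \<phi> + lam / 2 * (norm (\<phi> - \<theta>))\<^sup>2) \<phi>. True)"

definition task_obj ::
  "('a::real_inner \<Rightarrow> real) \<Rightarrow> ('a \<Rightarrow> real) \<Rightarrow> real \<Rightarrow> 'a \<Rightarrow> real" where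
  "task_obj f fh lam \<theta> = f (phi_star f fh lam 0 \<theta>)"

definition meta_obj ::
  "nat \<Rightarrow> (nat \<Rightarrow> 'a::real_inner \<Rightarrow> real) \<Rightarrow> (nat \<Rightarrow> 'a \<Rightarrow> real) \<Rightarrow> real \<Rightarrow> 'a \<Rightarrow> real" where
  "meta_obj M f fh lam \<theta> = 1 / real M * (\<Sum>i<M. task_obj (f i) (fh i) lam \<theta>)"

text \<open>The two meta-gradient estimators, as functions of the point \<open>p \<nu>'\<close> returned by the inner
  solver for perturbation \<open>\<nu>'\<close>.\<close>

definition forward_est :: "real \<Rightarrow> real \<Rightarrow> (real \<Rightarrow> 'a::real_vector) \<Rightarrow> 'a" where
  "forward_est lam nu p = - (lam *\<^sub>R ((1 / nu) *\<^sub>R (p nu - p 0)))"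

definition symmetric_est :: "real \<Rightarrow> real \<Rightarrow> (real \<Rightarrow> 'a::real_vector) \<Rightarrow> 'a" where
  "symmetric_est lam nu p = - (lam *\<^sub>R ((1 / (2 * nu)) *\<^sub>R (p nu - p (- nu))))"

definition batches :: "nat \<Rightarrow> nat \<Rightarrow> nat set set" where
  "batches M B = {S. S \<subseteq> {..<M} \<and> card S = B}"

text \<open>The iterate after a history of mini-batches, most recent batch first. The inner solver
  \<open>sol h i \<nu>' \<theta>\<close>, called for task \<open>i\<close> at the meta-parameter \<open>\<theta>\<close>, may depend on the history \<open>h\<close>
  of batches drawn so far, the current one included (e.g. because of warm starts).\<close>

primrec sgd_iterate ::
  "((real \<Rightarrow> 'a::real_vector) \<Rightarrow> 'a) \<Rightarrow> (nat set list \<Rightarrow> nat \<Rightarrow> real \<Rightarrow> 'a \<Rightarrow> 'a) \<Rightarrow>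
   nat \<Rightarrow> real \<Rightarrow> 'a \<Rightarrow> nat set list \<Rightarrow> 'a" where
  "sgd_iterate est sol B eta \<theta>0 [] = \<theta>0"
| "sgd_iterate est sol B eta \<theta>0 (S # h) =
     (let \<theta> = sgd_iterate est sol B eta \<theta>0 h in
      \<theta> - eta *\<^sub>R ((1 / real B) *\<^sub>R (\<Sum>i\<in>S. est (\<lambda>nu'. sol (S # h) i nu' \<theta>))))"

text \<open>Independent uniformly distributed mini-batches amount to a uniformly distributed history.\<close>

definition batch_histories :: "nat \<Rightarrow> nat \<Rightarrow> nat \<Rightarrow> nat set list pmf" where
  "batch_histories M B t = pmf_of_set {h. length h = t \<and> set h \<subseteq> batches M B}"

definition expected_grad_norm ::
  "nat \<Rightarrow> (nat \<Rightarrow> 'a::real_inner \<Rightarrow> real) \<Rightarrow> (nat \<Rightarrow> 'a \<Rightarrow> real) \<Rightarrow> real \<Rightarrow>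
   ((real \<Rightarrow> 'a) \<Rightarrow> 'a) \<Rightarrow> (nat set list \<Rightarrow> nat \<Rightarrow> real \<Rightarrow> 'a \<Rightarrow> 'a) \<Rightarrow>
   nat \<Rightarrow> real \<Rightarrow> 'a \<Rightarrow> nat \<Rightarrow> real" where
  "expected_grad_norm M f fh lam est sol B eta \<theta>0 t =
     measure_pmf.expectation (batch_histories M B t)
       (\<lambda>h. norm (grad (meta_obj M f fh lam) (sgd_iterate est sol B eta \<theta>0 h)))"

definition inner_accurate ::
  "nat \<Rightarrow> (nat \<Rightarrow> 'a::real_inner \<Rightarrow> real) \<Rightarrow> (nat \<Rightarrow> 'a \<Rightarrow> real) \<Rightarrow> real \<Rightarrow> real \<Rightarrow> real set \<Rightarrow>
   (nat set list \<Rightarrow> nat \<Rightarrow> real \<Rightarrow> 'a \<Rightarrow> 'a) \<Rightarrow> bool" where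
  "inner_accurate M f fh lam \<delta> N sol \<longleftrightarrow>
     (\<forall>h. \<forall>i<M. \<forall>nu'\<in>N. \<forall>\<theta>. norm (sol h i nu' \<theta> - phi_star (f i) (fh i) lam nu' \<theta>) \<le> \<delta>)"

text \<open>The constants hidden in the big-O bounds may depend neither on the dimension nor on the
  objectives. A constant quantified existentially in a theorem about \<open>real ^ 'n\<close> could still
  depend on the type \<open>'n\<close>, that is on the dimension; therefore explicit admissible values are
  fixed here. They are functions of the parameters on which the constants are allowed to depend,
  \<open>c1\<close> and \<open>c2\<close> being those of \<open>c1 * \<delta> powr a \<le> \<nu> \<le> c2 * \<delta> powr a\<close>. The values of the two bias
  constants come from Taylor expansions of the optimality condition of \<open>phi_star\<close> in \<open>\<nu>\<close> at 0
  (remainder) and from the inner accuracy \<open>\<delta>\<close> divided by the width of the difference quotient.\<close>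

definition step_const :: real where
  "step_const = 32"

definition taylor_const :: "real \<Rightarrow> real \<Rightarrow> real \<Rightarrow> real \<Rightarrow> real" where
  "taylor_const mu L0 L1 Lh2 = L0 * L1 / mu\<^sup>2 + Lh2 * L0\<^sup>2 / (2 * mu ^ 3)"

definition forward_const :: "real \<Rightarrow> real \<Rightarrow> real \<Rightarrow> real \<Rightarrow> real \<Rightarrow> real \<Rightarrow> real" where
  "forward_const mu L0 L1 Lh2 c1 c2 = 2 / c1 + c2 * taylor_const mu L0 L1 Lh2"

definition symmetric_const ::
  "real \<Rightarrow> real \<Rightarrow> real \<Rightarrow> real \<Rightarrow> real \<Rightarrow> real \<Rightarrow> real \<Rightarrow> real \<Rightarrow> real" where
  "symmetric_const mu L0 L1 L2 Lh2 Lh3 c1 c2 =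
     1 / c1 + c2\<^sup>2 / mu *
       (taylor_const mu L0 L1 Lh2 * (L1 + Lh2 * L0 / mu)
        + Lh3 * L0 ^ 3 / (6 * mu ^ 3) + L2 * L0\<^sup>2 / (2 * mu\<^sup>2))"

end

theory Submission
  imports Defs
begin

text \<open>By strong convexity the Hessian \<open>H\<close> of the regularised inner objective is bounded below by
  \<open>mu\<close>, and the implicit function theorem gives \<open>lam H\<inverse> \<nabla>f\<close> as the gradient of a task objective,
  which is \<open>- lam\<close> times the derivative of \<open>phi_star\<close> in \<open>\<nu>\<close> at 0. Taylor expansion of the
  optimality condition therefore bounds the error of both difference quotients, the even terms
  cancelling in the symmetric one. SGD with a gradient estimator of bias at most \<open>b\<close> is run with
  \<open>\<eta> = \<alpha> / Lsm\<close>, \<open>\<alpha> = \<epsilon> u / (4 (u\<^sup>2 + sigma2))\<close>, \<open>u = b + \<epsilon>\<close>: as long as the expected gradient norm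
  is at least \<open>u\<close>, the expected objective drops by \<open>\<eta> \<epsilon> u / 2\<close> per step, which can happen only for
  the stated number of steps.\<close>

section \<open>Gradients and Taylor remainders\<close>

text \<open>Nothing is differentiated with respect to \<open>nu\<close>. The term
  \<open>nu * f\<close> is carried as a residual of the equation for \<open>nu = 0\<close>, and the
  lower bound on the Hessian converts each residual into a distance. This suits an \<open>f\<close>
  without second derivative and makes every constant explicit and independent of the dimension. The
  inner solver may depend on the whole history, the current batch included, so the conditional mean
  of its error need not vanish. Unbiasedness and the variance bound are therefore used only for
  batch averages of exact task gradients; the estimate is a perturbation of these of norm at most
  \<open>b\<close>, batch by batch. The bias must enter the final bound with coefficient 1. At
  gradient norm \<open>u\<close> the first-order gain is \<open>u * (u - b)\<close>, and
  \<open>u = b + \<epsilon>\<close> makes it \<open>\<epsilon> * u\<close>.\<close>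

lemma GDERIV_unique:
  assumes "GDERIV f x :> D" "GDERIV f x :> E"
  shows "D = E"
proof -
  have "(\<lambda>h. h \<bullet> D) = (\<lambda>h. h \<bullet> E)"
    using assms unfolding gderiv_def by (rule has_derivative_unique)
  then have "(D - E) \<bullet> D = (D - E) \<bullet> E" by meson
  then have "(D - E) \<bullet> (D - E) = 0" by (simp add: inner_diff_right)
  then show ?thesis by simp
qed

lemma grad_eqI: "GDERIV f x :> D \<Longrightarrow> grad f x = D"
  unfolding grad_def by (blast intro: GDERIV_unique)

text \<open>Riesz representation in finite dimension: the functional \<open>f'\<close> is
  represented by \<open>adjoint f' 1\<close>.\<close>

lemma GDERIV_grad:
  fixes f :: "'a::euclidean_space \<Rightarrow> real"
  assumes "f differentiable (at x)"
  shows "GDERIV f x :> grad f x"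
proof -
  obtain f' where f': "(f has_derivative f') (at x)"
    using assms unfolding differentiable_def by blast
  then have lin: "linear f'" by (rule has_derivative_linear)
  have "f' = (\<lambda>h. h \<bullet> adjoint f' 1)"
    using adjoint_works[OF lin, where y = 1] by (simp add: fun_eq_iff)
  with f' have "GDERIV f x :> adjoint f' 1"
    unfolding gderiv_def by metis
  then show ?thesis using grad_eqI by metis
qed

lemma GDERIV_sum:
  assumes "\<And>i. i \<in> I \<Longrightarrow> GDERIV (f i) x :> D i"
  shows "GDERIV (\<lambda>y. \<Sum>i\<in>I. f i y) x :> (\<Sum>i\<in>I. D i)"
  using assms unfolding gderiv_def inner_sum_right by (intro has_derivative_sum) auto

lemma GDERIV_cmult: "GDERIV f x :> D \<Longrightarrow> GDERIV (\<lambda>y. c * f y) x :> c *\<^sub>R D"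
  unfolding gderiv_def inner_scaleR_right by (rule has_derivative_mult_right)

lemma GDERIV_half_norm_diff_sq:
  fixes x a :: "'a::real_inner"
  shows "GDERIV (\<lambda>y. lam / 2 * (norm (y - a))\<^sup>2) x :> lam *\<^sub>R (x - a)"
  unfolding gderiv_def power2_norm_eq_inner
  by (auto intro!: derivative_eq_intros simp: inner_commute algebra_simps)

lemma has_derivative_fderiv:
  assumes "g differentiable (at x)"
  shows "(g has_derivative blinfun_apply (fderiv g x)) (at x)"
  using assms unfolding fderiv_def
  by (metis bounded_linear_Blinfun_apply frechet_derivative_works has_derivative_bounded_linear)

text \<open>Along \<open>t *\<^sub>R v\<close> the increment and the linear part both scale with
  \<open>t\<close>, so after division by \<open>t\<close> the remainder costs only an arbitrary
  \<open>e\<close>. Later it bounds derivatives whose norms are not assumed directly: the third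
  derivative of \<open>fh\<close> by \<open>Lh2\<close> and the Hessian of \<open>f\<close> by
  \<open>L1\<close>.\<close>

lemma norm_has_derivative_le_lipschitz:
  fixes g :: "'a::real_normed_vector \<Rightarrow> 'b::real_normed_vector"
  assumes g: "(g has_derivative g') (at x)" and lip: "L-lipschitz_on UNIV g"
  shows "norm (g' v) \<le> L * norm v"
proof (cases "v = 0")
  case True
  then show ?thesis using has_derivative_linear[OF g] by (simp add: linear_0)
next
  case False
  have "norm (g' v) \<le> L * norm v + e" if "e > 0" for e
  proof -
    have "e / norm v > 0" using that False by simp
    then obtain d where d: "d > 0"
      "\<And>y. norm (y - x) < d \<Longrightarrow> norm (g y - g x - g' (y - x)) \<le> e / norm v * norm (y - x)"
      using g unfolding has_derivative_at_alt by blast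
    define t where "t = d / (2 * norm v)"
    have t: "t > 0" "norm (t *\<^sub>R v) < d" using d(1) False by (auto simp: t_def)
    have "t * norm (g' v) = norm (g' (t *\<^sub>R v))"
      using t(1) linear_scale[OF has_derivative_linear[OF g]] by simp
    also have "\<dots> \<le> norm (g (x + t *\<^sub>R v) - g x)
        + norm (g (x + t *\<^sub>R v) - g x - g' (t *\<^sub>R v))"
      by (metis add.commute diff_add_cancel norm_minus_commute norm_triangle_sub)
    also have "\<dots> \<le> L * norm (t *\<^sub>R v) + e / norm v * norm (t *\<^sub>R v)"
      using lipschitz_onD[OF lip, of "x + t *\<^sub>R v" x] d(2)[of "x + t *\<^sub>R v"] t(2)
      by (intro add_mono) (auto simp: dist_norm)
    also have "\<dots> = t * (L * norm v + e)" using t(1) False by (simp add: algebra_simps)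
    finally show ?thesis using t(1) by simp
  qed
  then show ?thesis by (rule field_le_epsilon)
qed

text \<open>In the two Taylor estimates the Lipschitz bound is stated along \<open>y - x\<close> only, so \<open>L\<close> absorbs
  one factor \<open>norm (y - x)\<close>.\<close>

lemma taylor_order1:
  fixes g :: "'a::real_normed_vector \<Rightarrow> 'b::real_normed_vector"
  assumes der: "\<And>z. (g has_derivative g' z) (at z)"
    and lip: "\<And>z. norm (g' z (y - x) - g' x (y - x)) \<le> L * norm (z - x)"
  shows "norm (g y - g x - g' x (y - x)) \<le> L / 2 * norm (y - x)"
proof -
  define d where "d = y - x"
  have lin: "linear (g' z)" for z using der by (rule has_derivative_linear)
  \<comment> \<open>With the linear part removed, the curve has speed at most
    \<open>L * norm d * t\<close>; the mean value inequality compares it with the primitive in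
    \<open>pd\<close>, which produces the factor 1/2.\<close>
  have vd: "((\<lambda>t. g (x + t *\<^sub>R d) - t *\<^sub>R g' x d) has_vector_derivative
      g' (x + t *\<^sub>R d) d - g' x d) (at t)" for t :: real
    unfolding has_vector_derivative_def
    by (auto intro!: derivative_eq_intros has_derivative_compose[OF _ der]
        simp: linear_scale[OF lin] algebra_simps)
  have pd: "((\<lambda>t. L * norm d / 2 * t\<^sup>2) has_vector_derivative L * norm d * t) (at t)" for t :: real
    unfolding has_real_derivative_iff_has_vector_derivative[symmetric]
    by (auto intro!: derivative_eq_intros)
  have "norm ((g (x + 1 *\<^sub>R d) - 1 *\<^sub>R g' x d) - (g (x + 0 *\<^sub>R d) - 0 *\<^sub>R g' x d))
      \<le> L * norm d / 2 * 1\<^sup>2 - L * norm d / 2 * 0\<^sup>2"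
  proof (rule differentiable_bound_general[OF _ _ _ vd pd])
    show "continuous_on {0..1} (\<lambda>t. g (x + t *\<^sub>R d) - t *\<^sub>R g' x d)"
      using vd by (intro continuous_at_imp_continuous_on) (auto intro: has_vector_derivative_continuous)
    show "norm (g' (x + t *\<^sub>R d) d - g' x d) \<le> L * norm d * t" if "0 < t" "t < 1" for t
      using lip[of "x + t *\<^sub>R d"] that by (simp add: d_def mult_ac)
  qed (auto intro!: continuous_intros)
  then show ?thesis by (simp add: d_def algebra_simps)
qed

lemma taylor_order2:
  fixes g :: "'a::real_normed_vector \<Rightarrow> 'b::real_normed_vector"
  assumes der: "\<And>z. (g has_derivative g' z) (at z)"
    and der2: "\<And>z. ((\<lambda>z. g' z (y - x)) has_derivative g'' z) (at z)"
    and lip: "\<And>z w. norm (g'' z w - g'' x w) \<le> L * norm (z - x) * norm w"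
  shows "norm (g y - g x - g' x (y - x) - (1/2) *\<^sub>R g'' x (y - x)) \<le> L / 6 * (norm (y - x))\<^sup>2"
proof -
  define d where "d = y - x"
  have lin: "linear (g' z)" for z using der by (rule has_derivative_linear)
  have lin2: "linear (g'' z)" for z using der2 by (rule has_derivative_linear)
  have vd: "((\<lambda>t. g (x + t *\<^sub>R d) - t *\<^sub>R g' x d - (t\<^sup>2 / 2) *\<^sub>R g'' x d) has_vector_derivative
      g' (x + t *\<^sub>R d) d - g' x d - t *\<^sub>R g'' x d) (at t)" for t :: real
    unfolding has_vector_derivative_def
    by (auto intro!: derivative_eq_intros has_derivative_compose[OF _ der]
        simp: linear_scale[OF lin] algebra_simps)
  have pd: "((\<lambda>t. L * (norm d)\<^sup>2 / 6 * t^3) has_vector_derivative L / 2 * (norm d)\<^sup>2 * t\<^sup>2) (at t)" for t :: real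
    unfolding has_real_derivative_iff_has_vector_derivative[symmetric]
    by (auto intro!: derivative_eq_intros simp: power2_eq_square)
  have "norm ((g (x + 1 *\<^sub>R d) - 1 *\<^sub>R g' x d - (1\<^sup>2 / 2) *\<^sub>R g'' x d)
       - (g (x + 0 *\<^sub>R d) - 0 *\<^sub>R g' x d - (0\<^sup>2 / 2) *\<^sub>R g'' x d))
      \<le> L * (norm d)\<^sup>2 / 6 * 1^3 - L * (norm d)\<^sup>2 / 6 * 0^3"
  proof (rule differentiable_bound_general[OF _ _ _ vd pd])
    show "continuous_on {0..1} (\<lambda>t. g (x + t *\<^sub>R d) - t *\<^sub>R g' x d - (t\<^sup>2 / 2) *\<^sub>R g'' x d)"
      using vd by (intro continuous_at_imp_continuous_on) (auto intro: has_vector_derivative_continuous)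
    fix t :: real assume t: "0 < t" "t < 1"
    \<comment> \<open>The speed of the curve is itself a first-order remainder, that of
      \<open>g'\<close> at the fixed vector \<open>d\<close>; its quadratic bound integrates to the
      factor 1/6.\<close>
    have "norm (g' (x + t *\<^sub>R d) d - g' x d - g'' x (x + t *\<^sub>R d - x))
        \<le> (L * norm (t *\<^sub>R d)) / 2 * norm (x + t *\<^sub>R d - x)"
    proof (rule taylor_order1)
      show "((\<lambda>z. g' z d) has_derivative g'' z) (at z)" for z using der2 by (simp add: d_def)
      show "norm (g'' z (x + t *\<^sub>R d - x) - g'' x (x + t *\<^sub>R d - x)) \<le> L * norm (t *\<^sub>R d) * norm (z - x)" for z
        using lip[of z "t *\<^sub>R d"] by (simp add: mult_ac)
    qed
    then show "norm (g' (x + t *\<^sub>R d) d - g' x d - t *\<^sub>R g'' x d) \<le> L / 2 * (norm d)\<^sup>2 * t\<^sup>2"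
      using t by (simp add: linear_scale[OF lin2] power2_eq_square mult_ac)
  qed (auto intro!: continuous_intros)
  then show ?thesis by (simp add: d_def algebra_simps)
qed

text \<open>Expand \<open>f (x + s u + s v)\<close> around \<open>x\<close> and around \<open>x + s u\<close>: the quadratic terms in which the
  two expansions differ are the asymmetry times \<open>s\<^sup>2 / 2\<close>, while all remainders are \<open>O(s\<^sup>3)\<close>.\<close>

lemma hessian_symmetric:
  fixes f :: "'a::real_inner \<Rightarrow> real"
  assumes f: "\<And>x. GDERIV f x :> g x"
    and g: "\<And>x. (g has_derivative blinfun_apply (H x)) (at x)"
    and lip: "L-lipschitz_on UNIV H"
  shows "H x u \<bullet> v = u \<bullet> H x v"
proof -
  have L0: "L \<ge> 0" using lip lipschitz_on_nonneg by blast
  have HL: "norm (H y w - H z w) \<le> L * norm (y - z) * norm w" for y z w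
  proof -
    have "norm (H y w - H z w) \<le> norm (H y - H z) * norm w"
      by (metis blinfun.diff_left norm_blinfun)
    also have "\<dots> \<le> L * norm (y - z) * norm w"
      using lipschitz_onD[OF lip, of y z] by (intro mult_right_mono) (auto simp: dist_norm)
    finally show ?thesis .
  qed
  have T: "\<bar>f (z + w) - f z - w \<bullet> g z - 1/2 * (w \<bullet> H z w)\<bar> \<le> L * (norm w)^3" for z w
  proof -
    have "norm (f (z + w) - f z - (z + w - z) \<bullet> g z - (1/2) *\<^sub>R ((z + w - z) \<bullet> H z (z + w - z)))
      \<le> L * norm w / 6 * (norm (z + w - z))\<^sup>2"
    proof (rule taylor_order2[where g' = "\<lambda>x h. h \<bullet> g x" and g'' = "\<lambda>x h. (z + w - z) \<bullet> H x h"])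
      show "(f has_derivative (\<lambda>w. w \<bullet> g x)) (at x)" for x using f by (simp add: gderiv_def)
      show "((\<lambda>y. (z + w - z) \<bullet> g y) has_derivative (\<lambda>h. (z + w - z) \<bullet> H x h)) (at x)" for x
        by (intro derivative_intros g)
      fix y h
      have "norm (w \<bullet> (H y h - H z h)) \<le> norm w * (L * norm (y - z) * norm h)"
        using Cauchy_Schwarz_ineq2 HL by (metis mult_left_mono norm_ge_zero order_trans real_norm_def)
      then show "norm ((z + w - z) \<bullet> H y h - (z + w - z) \<bullet> H z h) \<le> L * norm w * norm (y - z) * norm h"
        by (simp add: inner_diff_right mult_ac)
    qed
    moreover have "L * norm w / 6 * (norm w)\<^sup>2 \<le> L * (norm w)^3"
      using L0 by (simp add: power2_eq_square power3_eq_cube)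
    ultimately show ?thesis by simp
  qed
  have Ts: "\<bar>f (z + s *\<^sub>R w) - f z - s * (w \<bullet> g z) - 1/2 * (s\<^sup>2 * (w \<bullet> H z w))\<bar>
      \<le> s^3 * (L * (norm w)^3)" if "s > 0" for s z w
    using T[of z "s *\<^sub>R w"] that
    by (simp add: blinfun.scaleR_right power2_eq_square power_mult_distrib mult_ac)
  have T1: "\<bar>w \<bullet> (g (x + h) - g x - H x h)\<bar> \<le> norm w * (L * (norm h)\<^sup>2)" for w h
  proof -
    have "norm (g (x + h) - g x - H x (x + h - x)) \<le> L * norm h / 2 * norm (x + h - x)"
      using g HL by (intro taylor_order1) (auto simp: mult_ac)
    moreover have "L * norm h / 2 * norm h \<le> L * (norm h)\<^sup>2" using L0 by (simp add: power2_eq_square)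
    ultimately have "norm (g (x + h) - g x - H x h) \<le> L * (norm h)\<^sup>2" by simp
    then show ?thesis by (meson Cauchy_Schwarz_ineq2 mult_left_mono norm_ge_zero order_trans)
  qed
  have T2: "\<bar>w \<bullet> (H (x + h) w - H x w)\<bar> \<le> norm w * (L * norm h * norm w)" for w h
    using HL[of "x+h" w x] by (simp) (meson Cauchy_Schwarz_ineq2 mult_left_mono norm_ge_zero order_trans)
  \<comment> \<open>The letters stand for terms already scaled by \<open>s\<close>:
    \<open>su\<close>, \<open>sv\<close> linear and \<open>uu\<close> to \<open>vv\<close>
    quadratic, all at \<open>x\<close>; a prime marks evaluation at
    \<open>x + s *\<^sub>R u\<close>. \<open>e1\<close> to \<open>e3\<close> are errors of
    second-order expansions of \<open>f\<close>, \<open>e4\<close> that of the expansion of the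
    gradient, \<open>e5\<close> the variation of the Hessian.\<close>
  have arith: "\<bar>vu - uv\<bar> \<le> 2 * (e1 + e2 + e3 + e4 + e5)"
    if a: "\<bar>F3 - F0 - w - 1/2 * W\<bar> \<le> e1" "\<bar>F1 - F0 - su - 1/2 * uu\<bar> \<le> e2"
      "\<bar>F3 - F1 - sv' - 1/2 * vv'\<bar> \<le> e3" "\<bar>sv' - sv - vu\<bar> \<le> e4" "\<bar>vv' - vv\<bar> \<le> e5"
      and W: "W = uu + uv + vu + vv" "w = su + sv"
    for F0 F1 F3 w W su sv sv' uu uv vu vv vv' e1 e2 e3 e4 e5 :: real
  proof -
    have "vu - uv = 2 * (F3 - F0 - w - 1/2 * W) - 2 * (F1 - F0 - su - 1/2 * uu)
       - 2 * (F3 - F1 - sv' - 1/2 * vv') - 2 * (sv' - sv - vu) - (vv' - vv)"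
      unfolding W by (simp add: field_simps)
    also have "\<bar>\<dots>\<bar> \<le> 2 * \<bar>F3 - F0 - w - 1/2 * W\<bar> + 2 * \<bar>F1 - F0 - su - 1/2 * uu\<bar>
       + 2 * \<bar>F3 - F1 - sv' - 1/2 * vv'\<bar> + 2 * \<bar>sv' - sv - vu\<bar> + \<bar>vv' - vv\<bar>"
      using abs_triangle_ineq4 by (smt (verit))
    finally show ?thesis using a abs_ge_zero[of "vv' - vv"] by argo
  qed
  \<comment> \<open>Every remainder carries \<open>s ^ 3\<close> and the asymmetry only
    \<open>s\<^sup>2\<close>, so division leaves \<open>C * s\<close>, where \<open>C\<close>
    collects the five remainders.\<close>
  define C where "C = 2 * (L * (norm (u + v))^3 + L * (norm u)^3 + L * (norm v)^3
     + norm v * (L * (norm u)\<^sup>2) + norm v * (L * norm u * norm v))"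
  have key: "\<bar>H x u \<bullet> v - u \<bullet> H x v\<bar> \<le> C * s" if s: "s > 0" for s
  proof -
    have "\<bar>f (x + s *\<^sub>R u + s *\<^sub>R v) - f x - s * ((u + v) \<bullet> g x) - 1/2 * (s\<^sup>2 * ((u + v) \<bullet> H x (u + v)))\<bar>
       \<le> s^3 * (L * (norm (u + v))^3)"
      using Ts[OF s, of x "u + v"] by (simp only: scaleR_add_right add.assoc)
    moreover have "\<bar>f (x + s *\<^sub>R u) - f x - s * (u \<bullet> g x) - 1/2 * (s\<^sup>2 * (u \<bullet> H x u))\<bar>
       \<le> s^3 * (L * (norm u)^3)"
      by (rule Ts[OF s])
    moreover have "\<bar>f (x + s *\<^sub>R u + s *\<^sub>R v) - f (x + s *\<^sub>R u) - s * (v \<bullet> g (x + s *\<^sub>R u))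
       - 1/2 * (s\<^sup>2 * (v \<bullet> H (x + s *\<^sub>R u) v))\<bar> \<le> s^3 * (L * (norm v)^3)"
      by (rule Ts[OF s])
    moreover have "\<bar>s * (v \<bullet> g (x + s *\<^sub>R u)) - s * (v \<bullet> g x) - s\<^sup>2 * (v \<bullet> H x u)\<bar>
       \<le> s^3 * (norm v * (L * (norm u)\<^sup>2))"
      using T1[of "s *\<^sub>R v" "s *\<^sub>R u"] s
      by (simp add: blinfun.scaleR_right power2_eq_square power3_eq_cube inner_diff_right algebra_simps)
    moreover have "\<bar>s\<^sup>2 * (v \<bullet> H (x + s *\<^sub>R u) v) - s\<^sup>2 * (v \<bullet> H x v)\<bar>
       \<le> s^3 * (norm v * (L * norm u * norm v))"
      using T2[of "s *\<^sub>R v" "s *\<^sub>R u"] s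
      by (simp add: blinfun.scaleR_right power2_eq_square power3_eq_cube inner_diff_right algebra_simps)
    moreover have "s\<^sup>2 * ((u + v) \<bullet> H x (u + v)) =
       s\<^sup>2 * (u \<bullet> H x u) + s\<^sup>2 * (u \<bullet> H x v) + s\<^sup>2 * (v \<bullet> H x u) + s\<^sup>2 * (v \<bullet> H x v)"
      by (simp add: blinfun.add_right inner_add algebra_simps)
    moreover have "s * ((u + v) \<bullet> g x) = s * (u \<bullet> g x) + s * (v \<bullet> g x)"
      by (simp add: inner_add algebra_simps)
    ultimately have "\<bar>s\<^sup>2 * (v \<bullet> H x u) - s\<^sup>2 * (u \<bullet> H x v)\<bar> \<le> 2 * (s^3 * (L * (norm (u + v))^3)
       + s^3 * (L * (norm u)^3) + s^3 * (L * (norm v)^3) + s^3 * (norm v * (L * (norm u)\<^sup>2))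
       + s^3 * (norm v * (L * norm u * norm v)))"
      by (rule arith)
    then have "s\<^sup>2 * \<bar>H x u \<bullet> v - u \<bullet> H x v\<bar> \<le> s\<^sup>2 * (C * s)"
      by (simp add: C_def abs_mult[symmetric] inner_commute power2_eq_square power3_eq_cube algebra_simps)
         (simp add: abs_mult right_diff_distrib[symmetric])
    then show ?thesis using s by simp
  qed
  have C0: "C \<ge> 0" unfolding C_def using L0 by simp
  have "\<bar>H x u \<bullet> v - u \<bullet> H x v\<bar> \<le> e" if "e > 0" for e
  proof -
    have "C * (e / (C + 1)) \<le> e" using that C0 by (simp add: field_simps)
    then show ?thesis using key[of "e / (C + 1)"] that C0 by fastforce
  qed
  then have "\<bar>H x u \<bullet> v - u \<bullet> H x v\<bar> \<le> 0" by (rule field_le_epsilon) simp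
  then show ?thesis by simp
qed

text \<open>The descent lemma: a first-order Taylor estimate in which Cauchy-Schwarz moves
  \<open>norm d\<close> into the Lipschitz constant.\<close>

lemma lipschitz_gradient_descent:
  fixes F :: "'a::real_inner \<Rightarrow> real"
  assumes der: "\<And>x. GDERIV F x :> G x" and lip: "\<And>x y. norm (G x - G y) \<le> L * norm (x - y)"
  shows "F (x + d) \<le> F x + d \<bullet> G x + L / 2 * (norm d)\<^sup>2"
proof -
  have "norm (F (x + d) - F x - (x + d - x) \<bullet> G x) \<le> (L * norm d) / 2 * norm (x + d - x)"
  proof (rule taylor_order1[where g' = "\<lambda>x h. h \<bullet> G x"])
    show "(F has_derivative (\<lambda>h. h \<bullet> G z)) (at z)" for z using der by (simp add: gderiv_def)
    have "norm (d \<bullet> (G z - G x)) \<le> norm d * (L * norm (z - x))" for z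
      using Cauchy_Schwarz_ineq2 lip by (metis mult_left_mono norm_ge_zero order_trans real_norm_def)
    then show "norm ((x + d - x) \<bullet> G z - (x + d - x) \<bullet> G x) \<le> L * norm d * norm (z - x)" for z
      by (simp add: inner_diff_right mult_ac)
  qed
  then have "F (x + d) - F x - d \<bullet> G x \<le> L * norm d / 2 * norm d"
    unfolding real_norm_def abs_le_iff by simp
  then show ?thesis by (simp add: power2_eq_square)
qed

section \<open>The inner problem and the bias of the estimators\<close>

text \<open>Divide the defining inequality by \<open>t\<close> and let \<open>t\<close> tend to 0
  from the right: the left side becomes a directional derivative, and the factor
  \<open>1 - t\<close> of the quadratic term tends to 1.\<close>

lemma strongly_convex_gradient_ineq:
  fixes h :: "'a::real_inner \<Rightarrow> real"
  assumes sc: "strongly_convex mu h" and der: "GDERIV h x :> D"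
  shows "h x + (y - x) \<bullet> D + mu / 2 * (norm (y - x))\<^sup>2 \<le> h y"
proof -
  define d where "d = y - x"
  have comp: "((\<lambda>t. h (x + t *\<^sub>R d)) has_derivative (\<lambda>t. (t *\<^sub>R d) \<bullet> D)) (at 0)"
  proof -
    have "((\<lambda>t. x + t *\<^sub>R d) has_derivative (\<lambda>t. t *\<^sub>R d)) (at 0)"
      by (auto intro!: derivative_eq_intros)
    moreover have "(h has_derivative (\<lambda>w. w \<bullet> D)) (at (x + 0 *\<^sub>R d))"
      using der by (simp add: gderiv_def)
    ultimately show ?thesis using has_derivative_compose by blast
  qed
  then have "DERIV (\<lambda>t. h (x + t *\<^sub>R d)) 0 :> d \<bullet> D"
    unfolding has_field_derivative_def by (simp add: mult.commute[of _ "d \<bullet> D"])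
  then have lim: "((\<lambda>t. (h (x + t *\<^sub>R d) - h x) / t) \<longlongrightarrow> d \<bullet> D) (at_right 0)"
    unfolding DERIV_def by (auto intro: tendsto_mono at_le)
  have lim2: "((\<lambda>t. h y - h x - mu / 2 * (1 - t) * (norm d)\<^sup>2)
      \<longlongrightarrow> h y - h x - mu / 2 * (1 - 0) * (norm d)\<^sup>2) (at_right 0)"
    by (intro tendsto_intros)
  have "\<forall>\<^sub>F t in at_right 0. (h (x + t *\<^sub>R d) - h x) / t \<le> h y - h x - mu / 2 * (1 - t) * (norm d)\<^sup>2"
    unfolding eventually_at_right_field
  proof (intro exI[of _ 1] conjI allI impI)
    fix t :: real assume t: "0 < t" "t < 1"
    have "h ((1 - t) *\<^sub>R x + t *\<^sub>R y) \<le> (1 - t) * h x + t * h y - mu / 2 * t * (1 - t) * (norm (x - y))\<^sup>2"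
      using sc t unfolding strongly_convex_def by simp
    moreover have "(1 - t) *\<^sub>R x + t *\<^sub>R y = x + t *\<^sub>R d" by (simp add: d_def algebra_simps)
    ultimately have "h (x + t *\<^sub>R d) - h x \<le> t * (h y - h x - mu / 2 * (1 - t) * (norm d)\<^sup>2)"
      by (simp add: d_def norm_minus_commute algebra_simps)
    then show "(h (x + t *\<^sub>R d) - h x) / t \<le> h y - h x - mu / 2 * (1 - t) * (norm d)\<^sup>2"
      using t by (simp add: pos_divide_le_eq mult.commute)
  qed simp
  from tendsto_le[OF _ lim2 lim this] show ?thesis by (simp add: d_def)
qed

text \<open>Adding the gradient inequalities at \<open>x\<close> and at \<open>y\<close> cancels the
  function values. Cauchy-Schwarz then gives the norm form, which turns residuals of the
  stationarity equation into distances.\<close>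

lemma strongly_convex_strongly_monotone:
  fixes h :: "'a::real_inner \<Rightarrow> real"
  assumes sc: "strongly_convex mu h" and der: "\<And>x. GDERIV h x :> D x"
  shows "mu * norm (x - y) \<le> norm (D x - D y)"
proof (cases "x = y")
  case False
  have "mu * (norm (x - y))\<^sup>2 \<le> (x - y) \<bullet> (D x - D y)"
    using strongly_convex_gradient_ineq[OF sc der, of x y] strongly_convex_gradient_ineq[OF sc der, of y x]
    by (simp add: norm_minus_commute inner_diff algebra_simps)
  also have "\<dots> \<le> norm (x - y) * norm (D x - D y)" by (rule norm_cauchy_schwarz)
  finally show ?thesis using False by (simp add: power2_eq_square mult_ac)
qed simp

text \<open>Counterpart of \<open>norm_has_derivative_le_lipschitz\<close>: dividing by
  \<open>t\<close> carries a lower bound on increments over to the derivative. Thus strong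
  monotonicity bounds the Hessian from below.\<close>

lemma has_derivative_expanding:
  fixes g :: "'a::real_normed_vector \<Rightarrow> 'b::real_normed_vector"
  assumes g: "(g has_derivative g') (at x)" and exp: "\<And>y. mu * norm (y - x) \<le> norm (g y - g x)"
  shows "mu * norm v \<le> norm (g' v)"
proof (cases "v = 0")
  case False
  have "mu * norm v \<le> norm (g' v) + e" if "e > 0" for e
  proof -
    have "e / norm v > 0" using that False by simp
    then obtain d where d: "d > 0"
      "\<And>y. norm (y - x) < d \<Longrightarrow> norm (g y - g x - g' (y - x)) \<le> e / norm v * norm (y - x)"
      using g unfolding has_derivative_at_alt by blast
    define t where "t = d / (2 * norm v)"
    have t: "t > 0" "norm (t *\<^sub>R v) < d" using d(1) False by (auto simp: t_def)
    have "mu * norm (t *\<^sub>R v) \<le> norm (g (x + t *\<^sub>R v) - g x)" using exp[of "x + t *\<^sub>R v"] by simp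
    also have "\<dots> \<le> norm (g' (t *\<^sub>R v)) + norm (g (x + t *\<^sub>R v) - g x - g' (t *\<^sub>R v))"
      by (rule norm_triangle_sub)
    also have "\<dots> \<le> norm (g' (t *\<^sub>R v)) + e / norm v * norm (t *\<^sub>R v)"
      using d(2)[of "x + t *\<^sub>R v"] t(2) by simp
    also have "\<dots> = t * (norm (g' v) + e)"
      using t(1) False linear_scale[OF has_derivative_linear[OF g]] by (simp add: algebra_simps)
    finally have "t * (mu * norm v) \<le> t * (norm (g' v) + e)" using t(1) by (simp add: mult_ac)
    then show ?thesis using t(1) by simp
  qed
  then show ?thesis by (rule field_le_epsilon)
qed simp

text \<open>Test the derivative in the direction \<open>D\<close> itself.\<close>

lemma GDERIV_norm_le_lipschitz:
  fixes f :: "'a::real_inner \<Rightarrow> real"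
  assumes "GDERIV f x :> D" "L-lipschitz_on UNIV f"
  shows "norm D \<le> L"
proof (cases "D = 0")
  case True
  then show ?thesis using lipschitz_on_nonneg[OF assms(2)] by simp
next
  case False
  have "norm (D \<bullet> D) \<le> L * norm D"
    using norm_has_derivative_le_lipschitz[OF _ assms(2), of "\<lambda>h. h \<bullet> D" x D] assms(1)
    by (simp add: gderiv_def)
  then show ?thesis using False by (simp add: power2_norm_eq_inner[symmetric] power2_eq_square)
qed

text \<open>Outside the ball of radius \<open>\<bar>c\<bar> / a\<close> the quadratic term dominates
  the linear one, so \<open>J\<close> is at least \<open>J 0\<close> there and a minimum over the
  compact ball is global.\<close>

lemma coercive_attains_min:
  fixes J :: "'a::euclidean_space \<Rightarrow> real"
  assumes cont: "continuous_on UNIV J" and a: "a > 0"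
    and coerc: "\<And>x. J 0 + a * (norm x)\<^sup>2 - c * norm x \<le> J x"
  shows "\<exists>x. \<forall>y. J x \<le> J y"
proof -
  define R where "R = \<bar>c\<bar> / a"
  have R: "R \<ge> 0" using a by (simp add: R_def)
  have "continuous_on (cball 0 R) J" using cont continuous_on_subset by blast
  moreover have "cball 0 R \<noteq> ({} :: 'a set)" using R by auto
  ultimately obtain x where x: "x \<in> cball 0 R" "\<And>y. y \<in> cball 0 R \<Longrightarrow> J x \<le> J y"
    using continuous_attains_inf[of "cball 0 R" J] by auto
  have "J x \<le> J y" for y
  proof (cases "y \<in> cball 0 R")
    case False
    then have "\<bar>c\<bar> \<le> a * norm y" using a by (simp add: R_def field_simps)
    then have "c * norm y \<le> a * norm y * norm y"
      by (intro mult_right_mono) auto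
    then have "J 0 \<le> J y" using coerc[of y] by (simp add: power2_eq_square mult_ac)
    moreover have "J x \<le> J 0" using R by (intro x(2)) simp
    ultimately show ?thesis by linarith
  qed (rule x(2))
  then show ?thesis by blast
qed

text \<open>\<open>phi_star\<close> is a choice operator, so nothing is known about it until some
  minimiser has been exhibited.\<close>

lemma ARG_MIN_le:
  fixes J :: "'a \<Rightarrow> real"
  assumes "\<forall>y. J x \<le> J y"
  shows "J (ARG_MIN J z. True) \<le> J y"
proof -
  have "is_arg_min J (\<lambda>_. True) (ARG_MIN J z. True)"
    unfolding arg_min_def by (rule someI[of _ x]) (use assms in \<open>auto simp: is_arg_min_def not_less\<close>)
  then show ?thesis by (auto simp: is_arg_min_def not_less)
qed

text \<open>One task, with constants common to all tasks. The higher smoothness of the symmetric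
  case is kept as hypotheses of the lemmas that use it, so that one locale serves both
  estimators.\<close>

locale task =
  fixes f fh :: "'a::euclidean_space \<Rightarrow> real" and lam mu L0 L1 Lh2 :: real
  assumes lam: "lam > 0" and mu: "mu > 0"
    and fh_diff: "fh differentiable_on UNIV"
    and fh_diff2: "grad fh differentiable_on UNIV"
    and fh_hess: "Lh2-lipschitz_on UNIV (fderiv (grad fh))"
    and f_diff: "f differentiable_on UNIV"
    and f_lip: "L0-lipschitz_on UNIV f"
    and f_grad: "L1-lipschitz_on UNIV (grad f)"
    and inner_convex: "strongly_convex mu (\<lambda>\<phi>. fh \<phi> + lam / 2 * (norm \<phi>)\<^sup>2)"
begin

lemma f_GDERIV: "GDERIV f x :> grad f x"
  using f_diff by (intro GDERIV_grad) (simp add: differentiable_on_def)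

lemma fh_GDERIV: "GDERIV fh x :> grad fh x"
  using fh_diff by (intro GDERIV_grad) (simp add: differentiable_on_def)

lemma reg_GDERIV: "GDERIV (\<lambda>\<phi>. fh \<phi> + lam / 2 * (norm \<phi>)\<^sup>2) x :> grad fh x + lam *\<^sub>R x"
  using GDERIV_add[OF fh_GDERIV GDERIV_half_norm_diff_sq[of lam 0]] by simp

text \<open>The Hessian of the inner objective at \<open>nu = 0\<close>, the same for every
  \<theta>. The contribution of \<open>nu * f\<close> is left out because \<open>f\<close> need not
  be twice differentiable.\<close>

definition "hess x v = fderiv (grad fh) x v + lam *\<^sub>R v"

lemma hess_has_derivative: "((\<lambda>y. grad fh y + lam *\<^sub>R y) has_derivative hess x) (at x)"
proof -
  have "(grad fh has_derivative blinfun_apply (fderiv (grad fh) x)) (at x)"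
    using fh_diff2 by (intro has_derivative_fderiv) (simp add: differentiable_on_def)
  then show ?thesis unfolding hess_def by (auto intro!: derivative_eq_intros)
qed

lemma linear_hess: "linear (hess x)"
  using hess_has_derivative has_derivative_linear by blast

lemma strongly_monotone:
  "mu * norm (x - y) \<le> norm ((grad fh x + lam *\<^sub>R x) - (grad fh y + lam *\<^sub>R y))"
  by (rule strongly_convex_strongly_monotone[OF inner_convex reg_GDERIV])

lemma hess_lower: "mu * norm v \<le> norm (hess x v)"
  by (rule has_derivative_expanding[OF hess_has_derivative strongly_monotone])

lemma hess_symmetric: "hess x u \<bullet> v = u \<bullet> hess x v"
proof -
  have "(grad fh has_derivative blinfun_apply (fderiv (grad fh) x)) (at x)" for x
    using fh_diff2 by (intro has_derivative_fderiv) (simp add: differentiable_on_def)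
  from hessian_symmetric[OF fh_GDERIV this fh_hess]
  show ?thesis by (simp add: hess_def inner_add inner_commute)
qed

text \<open>In finite dimension the lower bound \<open>hess_lower\<close> already gives bijectivity,
  since injective endomorphisms are surjective.\<close>

lemma hess_inverse:
  obtains k where "linear k" "\<And>v. hess x (k v) = v" "\<And>v. k (hess x v) = v"
proof -
  have "inj (hess x)"
  proof (rule linear_injective_0[OF linear_hess, THEN iffD2], intro allI impI)
    fix v assume "hess x v = 0"
    then show "v = 0" using hess_lower[of v x] mu by (simp add: mult_le_0_iff)
  qed
  then have "surj (hess x)" using linear_injective_imp_surjective[OF linear_hess] by blast
  with \<open>inj (hess x)\<close> that show thesis
    by (meson bij_betw_def inj_linear_imp_inv_linear[OF linear_hess] inv_f_f surj_f_inv_f)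
qed

text \<open>A Lipschitz \<open>f\<close> changes at most linearly, so for either sign of
  \<open>nu\<close> the quadratic growth coming from strong convexity prevails and a minimiser
  exists.\<close>

lemma phi_star_min:
  "nu * f (phi_star f fh lam nu \<theta>) + fh (phi_star f fh lam nu \<theta>) + lam / 2 * (norm (phi_star f fh lam nu \<theta> - \<theta>))\<^sup>2
    \<le> nu * f y + fh y + lam / 2 * (norm (y - \<theta>))\<^sup>2"
proof -
  define J where "J \<phi> = nu * f \<phi> + fh \<phi> + lam / 2 * (norm (\<phi> - \<theta>))\<^sup>2" for \<phi>
  have "\<exists>x. \<forall>y. J x \<le> J y"
  proof (rule coercive_attains_min)
    have "continuous_on UNIV f" "continuous_on UNIV fh"
      using f_diff fh_diff by (auto intro: differentiable_imp_continuous_on)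
    then show "continuous_on UNIV J" unfolding J_def by (intro continuous_intros)
    show "mu / 2 > 0" using mu by simp
    fix x
    \<comment> \<open>The gradient at 0 of the unperturbed inner objective.\<close>
    define D where "D = grad fh 0 - lam *\<^sub>R \<theta>"
    have "fh 0 + x \<bullet> grad fh 0 + mu / 2 * (norm x)\<^sup>2 \<le> fh x + lam / 2 * (norm x)\<^sup>2"
      using strongly_convex_gradient_ineq[OF inner_convex reg_GDERIV, of 0 x] by simp
    moreover have "lam / 2 * (norm (x - \<theta>))\<^sup>2 = lam / 2 * (norm x)\<^sup>2 - lam * (x \<bullet> \<theta>) + lam / 2 * (norm \<theta>)\<^sup>2"
      by (simp add: power2_norm_eq_inner inner_diff inner_commute algebra_simps)
    moreover have "x \<bullet> D \<ge> - (norm D * norm x)"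
      using Cauchy_Schwarz_ineq2[of x D] by (simp add: abs_le_iff mult.commute)
    moreover have "x \<bullet> D = x \<bullet> grad fh 0 - lam * (x \<bullet> \<theta>)" by (simp add: D_def inner_diff_right)
    moreover have "nu * f 0 - \<bar>nu\<bar> * L0 * norm x \<le> nu * f x"
    proof -
      have "\<bar>f x - f 0\<bar> \<le> L0 * norm x"
        using lipschitz_onD[OF f_lip, of x 0] by (simp add: dist_norm)
      then have "\<bar>nu\<bar> * \<bar>f x - f 0\<bar> \<le> \<bar>nu\<bar> * (L0 * norm x)" by (intro mult_left_mono) auto
      then have "\<bar>nu * f x - nu * f 0\<bar> \<le> \<bar>nu\<bar> * (L0 * norm x)"
        by (simp add: abs_mult[symmetric] right_diff_distrib)
      then show ?thesis by (simp add: abs_le_iff mult_ac)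
    qed
    ultimately show "J 0 + mu / 2 * (norm x)\<^sup>2 - (norm D + \<bar>nu\<bar> * L0) * norm x \<le> J x"
      by (simp add: J_def algebra_simps)
  qed
  then obtain x where "\<forall>y. J x \<le> J y" by blast
  from ARG_MIN_le[OF this] show ?thesis unfolding phi_star_def J_def by blast
qed

text \<open>Fermat's rule. The gradient of \<open>f\<close> stands on the right because it is the
  residual with respect to the equation for \<open>nu = 0\<close>.\<close>

lemma phi_star_stationary:
  "grad fh (phi_star f fh lam nu \<theta>) + lam *\<^sub>R (phi_star f fh lam nu \<theta> - \<theta>)
    = - (nu *\<^sub>R grad f (phi_star f fh lam nu \<theta>))"
proof -
  let ?p = "phi_star f fh lam nu \<theta>"
  define D where "D = nu *\<^sub>R grad f ?p + grad fh ?p + lam *\<^sub>R (?p - \<theta>)"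
  have "GDERIV (\<lambda>\<phi>. nu * f \<phi> + fh \<phi> + lam / 2 * (norm (\<phi> - \<theta>))\<^sup>2) ?p :> D"
    unfolding D_def
    by (intro GDERIV_add GDERIV_cmult f_GDERIV fh_GDERIV GDERIV_half_norm_diff_sq)
  then have "(\<lambda>h. h \<bullet> D) = (\<lambda>h. 0)"
    unfolding gderiv_def using phi_star_min[of nu \<theta>]
    by (intro has_derivative_local_min[where x = ?p]) (auto intro: always_eventually)
  then have "D \<bullet> D = 0" by meson
  then have "D = 0" by simp
  then show ?thesis unfolding D_def by (simp add: algebra_simps eq_neg_iff_add_eq_0)
qed

lemma norm_grad_f_le: "norm (grad f x) \<le> L0"
  by (rule GDERIV_norm_le_lipschitz[OF f_GDERIV f_lip])

lemma phi_star_0_dist: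
  "mu * norm (phi_star f fh lam 0 \<theta> - phi_star f fh lam 0 \<theta>') \<le> lam * norm (\<theta> - \<theta>')"
proof -
  let ?p = "phi_star f fh lam 0 \<theta>" and ?q = "phi_star f fh lam 0 \<theta>'"
  have "(grad fh ?p + lam *\<^sub>R ?p) - (grad fh ?q + lam *\<^sub>R ?q) = lam *\<^sub>R (\<theta> - \<theta>')"
    using phi_star_stationary[of 0 \<theta>] phi_star_stationary[of 0 \<theta>']
    by (simp add: algebra_simps)
  then show ?thesis using strongly_monotone[of ?p ?q] lam by simp
qed

text \<open>The gradient is expressed through a solution \<open>w\<close> of the Hessian system
  because the same \<open>w\<close> is, up to sign, the first-order coefficient of
  \<open>phi_star\<close> in \<open>nu\<close>.\<close>

lemma task_obj_GDERIV:
  assumes w: "hess (phi_star f fh lam 0 \<theta>) w = grad f (phi_star f fh lam 0 \<theta>)"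
  shows "GDERIV (task_obj f fh lam) \<theta> :> lam *\<^sub>R w"
proof -
  let ?p = "phi_star f fh lam 0"
  obtain k where k: "linear k" "\<And>v. hess (?p \<theta>) (k v) = v" "\<And>v. k (hess (?p \<theta>) v) = v"
    using hess_inverse by blast
  \<comment> \<open>Stationarity at \<open>nu = 0\<close> makes \<open>?p\<close> a right inverse of
    the regularised gradient map divided by \<open>lam\<close>. Besides an invertible derivative,
    the rule for inverses asks for continuity of \<open>?p\<close>, which its Lipschitz constant
    \<open>lam / mu\<close> supplies.\<close>
  have "(?p has_derivative (\<lambda>v. k (lam *\<^sub>R v))) (at \<theta>)"
  proof (rule has_derivative_inverse_basic[where f = "\<lambda>y. (1 / lam) *\<^sub>R (grad fh y + lam *\<^sub>R y)"
        and f' = "\<lambda>v. (1 / lam) *\<^sub>R hess (?p \<theta>) v" and T = UNIV])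
    show "((\<lambda>y. (1 / lam) *\<^sub>R (grad fh y + lam *\<^sub>R y)) has_derivative (\<lambda>v. (1 / lam) *\<^sub>R hess (?p \<theta>) v)) (at (?p \<theta>))"
      by (rule has_derivative_scaleR_right[OF hess_has_derivative])
    show "bounded_linear (\<lambda>v. k (lam *\<^sub>R v))"
      using bounded_linear_compose[OF _ bounded_linear_scaleR_right, of k lam] k(1)
      by (simp add: linear_conv_bounded_linear)
    show "(\<lambda>v. k (lam *\<^sub>R v)) \<circ> (\<lambda>v. (1 / lam) *\<^sub>R hess (?p \<theta>) v) = id"
      using lam k(3) by (auto simp: fun_eq_iff)
    have "(lam / mu)-lipschitz_on UNIV ?p"
      using phi_star_0_dist lam mu by (intro lipschitz_onI) (auto simp: dist_norm field_simps)
    then show "continuous (at \<theta>) ?p"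
      using lipschitz_on_continuous_on continuous_on_eq_continuous_at by blast
    show "(1 / lam) *\<^sub>R (grad fh (?p z) + lam *\<^sub>R ?p z) = z" for z
      using phi_star_stationary[of 0 z] lam by (simp add: algebra_simps)
  qed auto
  from has_derivative_compose[OF this, of f "\<lambda>h. h \<bullet> grad f (?p \<theta>)"]
  have "((\<lambda>x. f (?p x)) has_derivative (\<lambda>v. k (lam *\<^sub>R v) \<bullet> grad f (?p \<theta>))) (at \<theta>)"
    using f_GDERIV by (simp add: gderiv_def)
  \<comment> \<open>The chain rule yields the adjoint of \<open>k\<close>; symmetry of the Hessian turns it back into \<open>k\<close>.\<close>
  moreover have "k (lam *\<^sub>R v) \<bullet> grad f (?p \<theta>) = v \<bullet> (lam *\<^sub>R w)" for v
    using hess_symmetric[of "?p \<theta>" "k (lam *\<^sub>R v)" w] k(2) w by simp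
  ultimately show ?thesis unfolding gderiv_def task_obj_def by (simp add: fun_eq_iff)
qed

section \<open>Expansion of the inner solution in \<open>nu\<close>\<close>

lemma phi_star_displacement:
  "norm (phi_star f fh lam nu \<theta> - phi_star f fh lam 0 \<theta>) \<le> \<bar>nu\<bar> * L0 / mu"
proof -
  let ?p = "phi_star f fh lam nu \<theta>" and ?q = "phi_star f fh lam 0 \<theta>"
  have "(grad fh ?p + lam *\<^sub>R ?p) - (grad fh ?q + lam *\<^sub>R ?q) = - (nu *\<^sub>R grad f ?p)"
    using phi_star_stationary[of nu \<theta>] phi_star_stationary[of 0 \<theta>] by (simp add: algebra_simps)
  then have "mu * norm (?p - ?q) \<le> \<bar>nu\<bar> * norm (grad f ?p)"
    using strongly_monotone[of ?p ?q] by simp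
  also have "\<dots> \<le> \<bar>nu\<bar> * L0" using norm_grad_f_le by (intro mult_left_mono) auto
  finally show ?thesis using mu by (simp add: field_simps)
qed

lemma hess_taylor1:
  "norm ((grad fh y + lam *\<^sub>R y) - (grad fh x + lam *\<^sub>R x) - hess x (y - x)) \<le> Lh2 / 2 * (norm (y - x))\<^sup>2"
proof -
  have "norm ((grad fh y + lam *\<^sub>R y) - (grad fh x + lam *\<^sub>R x) - hess x (y - x))
      \<le> (Lh2 * norm (y - x)) / 2 * norm (y - x)"
  proof (rule taylor_order1[OF hess_has_derivative])
    fix z
    have "norm (fderiv (grad fh) z (y - x) - fderiv (grad fh) x (y - x))
        \<le> norm (fderiv (grad fh) z - fderiv (grad fh) x) * norm (y - x)"
      by (metis blinfun.diff_left norm_blinfun)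
    also have "\<dots> \<le> Lh2 * norm (z - x) * norm (y - x)"
      using lipschitz_onD[OF fh_hess, of z x] by (intro mult_right_mono) (auto simp: dist_norm)
    finally show "norm (hess z (y - x) - hess x (y - x)) \<le> Lh2 * norm (y - x) * norm (z - x)"
      by (simp add: hess_def mult_ac)
  qed
  then show ?thesis by (simp add: power2_eq_square)
qed

text \<open>Applied to the remainder, the Hessian at the unperturbed solution leaves the change of
  \<open>grad f\<close> over the displacement and the Taylor error of \<open>grad fh\<close>, both
  quadratic in \<open>nu\<close>. They yield the two summands of \<open>taylor_const\<close>: each
  displacement costs \<open>L0 / mu\<close>, and inverting the Hessian costs another
  \<open>1 / mu\<close>.\<close>

lemma phi_star_taylor1:
  assumes w: "hess (phi_star f fh lam 0 \<theta>) w = grad f (phi_star f fh lam 0 \<theta>)"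
  shows "norm (phi_star f fh lam nu \<theta> - phi_star f fh lam 0 \<theta> + nu *\<^sub>R w) \<le> nu\<^sup>2 * taylor_const mu L0 L1 Lh2"
proof -
  let ?p = "phi_star f fh lam nu \<theta>" and ?q = "phi_star f fh lam 0 \<theta>"
  define r where "r = (grad fh ?p + lam *\<^sub>R ?p) - (grad fh ?q + lam *\<^sub>R ?q) - hess ?q (?p - ?q)"
  have nn: "L0 \<ge> 0" "L1 \<ge> 0" "Lh2 \<ge> 0"
    using f_lip f_grad fh_hess lipschitz_on_nonneg by blast+
  have r: "norm r \<le> Lh2 / 2 * (\<bar>nu\<bar> * L0 / mu)\<^sup>2"
  proof -
    have "norm r \<le> Lh2 / 2 * (norm (?p - ?q))\<^sup>2" unfolding r_def by (rule hess_taylor1)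
    also have "\<dots> \<le> Lh2 / 2 * (\<bar>nu\<bar> * L0 / mu)\<^sup>2"
      using nn by (intro mult_left_mono power_mono phi_star_displacement) auto
    finally show ?thesis .
  qed
  have g: "norm (nu *\<^sub>R (grad f ?p - grad f ?q)) \<le> \<bar>nu\<bar> * (L1 * (\<bar>nu\<bar> * L0 / mu))"
  proof -
    have "norm (grad f ?p - grad f ?q) \<le> L1 * norm (?p - ?q)"
      using lipschitz_onD[OF f_grad, of ?p ?q] by (simp add: dist_norm)
    also have "\<dots> \<le> L1 * (\<bar>nu\<bar> * L0 / mu)"
      using nn by (intro mult_left_mono phi_star_displacement) auto
    finally have "norm (grad f ?p - grad f ?q) \<le> L1 * (\<bar>nu\<bar> * L0 / mu)" .
    from mult_left_mono[OF this abs_ge_zero[of nu]] show ?thesis by simp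
  qed
  have "(grad fh ?p + lam *\<^sub>R ?p) - (grad fh ?q + lam *\<^sub>R ?q) = - (nu *\<^sub>R grad f ?p)"
    using phi_star_stationary[of nu \<theta>] phi_star_stationary[of 0 \<theta>] by (simp add: algebra_simps)
  then have "hess ?q (?p - ?q) = - (nu *\<^sub>R grad f ?p) - r" unfolding r_def by simp
  then have "hess ?q (?p - ?q + nu *\<^sub>R w) = - (nu *\<^sub>R (grad f ?p - grad f ?q)) - r"
    by (simp add: linear_add[OF linear_hess] linear_scale[OF linear_hess] w scaleR_diff_right)
  then have "mu * norm (?p - ?q + nu *\<^sub>R w) \<le> norm (- (nu *\<^sub>R (grad f ?p - grad f ?q)) - r)"
    using hess_lower by metis
  also have "\<dots> \<le> norm (nu *\<^sub>R (grad f ?p - grad f ?q)) + norm r"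
    by (metis norm_minus_cancel norm_triangle_ineq4)
  also have "\<dots> \<le> \<bar>nu\<bar> * (L1 * (\<bar>nu\<bar> * L0 / mu)) + Lh2 / 2 * (\<bar>nu\<bar> * L0 / mu)\<^sup>2"
    using g r by (rule add_mono)
  also have "\<dots> = mu * (nu\<^sup>2 * taylor_const mu L0 L1 Lh2)"
    using mu unfolding taylor_const_def
    by (simp add: field_simps power2_eq_square power3_eq_cube)
  finally show ?thesis using mu by simp
qed

text \<open>The solver errors are amplified by \<open>1 / nu\<close>, while the expansion error
  grows with \<open>nu\<close>; equating the two orders gives \<open>nu\<close> of order
  \<open>sqrt \<delta>\<close>.\<close>

lemma forward_est_error:
  assumes w: "hess (phi_star f fh lam 0 \<theta>) w = grad f (phi_star f fh lam 0 \<theta>)" and nu: "nu > 0"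
    and p: "norm (p nu - phi_star f fh lam nu \<theta>) \<le> \<delta>" "norm (p 0 - phi_star f fh lam 0 \<theta>) \<le> \<delta>"
  shows "norm (forward_est lam nu p - lam *\<^sub>R w) \<le> lam * (2 * \<delta> / nu + nu * taylor_const mu L0 L1 Lh2)"
proof -
  let ?p = "phi_star f fh lam nu \<theta>" and ?q = "phi_star f fh lam 0 \<theta>"
  have "forward_est lam nu p - lam *\<^sub>R w
      = - ((lam / nu) *\<^sub>R ((p nu - ?p) - (p 0 - ?q) + (?p - ?q + nu *\<^sub>R w)))"
    using nu by (simp add: forward_est_def algebra_simps)
  then have "norm (forward_est lam nu p - lam *\<^sub>R w)
      = lam / nu * norm ((p nu - ?p) - (p 0 - ?q) + (?p - ?q + nu *\<^sub>R w))"
    using lam nu by simp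
  also have "\<dots> \<le> lam / nu * (\<delta> + \<delta> + nu\<^sup>2 * taylor_const mu L0 L1 Lh2)"
    using lam nu p phi_star_taylor1[OF w, of nu]
    by (intro mult_left_mono norm_triangle_mono norm_triangle_le_diff) auto
  also have "\<dots> = lam * (2 * \<delta> / nu + nu * taylor_const mu L0 L1 Lh2)"
    using nu by (simp add: field_simps power2_eq_square)
  finally show ?thesis .
qed

lemma hess_taylor2:
  assumes d2: "fderiv (grad fh) differentiable_on UNIV"
    and lip: "Lh3-lipschitz_on UNIV (fderiv (fderiv (grad fh)))"
  shows "norm ((grad fh y + lam *\<^sub>R y) - (grad fh x + lam *\<^sub>R x) - hess x (y - x)
      - (1/2) *\<^sub>R fderiv (fderiv (grad fh)) x (y - x) (y - x)) \<le> Lh3 / 6 * (norm (y - x)) ^ 3"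
proof -
  let ?D = "fderiv (fderiv (grad fh))"
  have "norm ((grad fh y + lam *\<^sub>R y) - (grad fh x + lam *\<^sub>R x) - hess x (y - x)
      - (1/2) *\<^sub>R ?D x (y - x) (y - x)) \<le> (Lh3 * norm (y - x)) / 6 * (norm (y - x))\<^sup>2"
  proof (rule taylor_order2[OF hess_has_derivative, where g'' = "\<lambda>z w. ?D z w (y - x)"])
    show "((\<lambda>z. hess z (y - x)) has_derivative (\<lambda>w. ?D z w (y - x))) (at z)" for z
    proof -
      have "(fderiv (grad fh) has_derivative blinfun_apply (?D z)) (at z)"
        using d2 by (intro has_derivative_fderiv) (simp add: differentiable_on_def)
      note blinfun_der = bounded_linear.has_derivative[OF blinfun.bounded_linear_left this, of "y - x"]
      from has_derivative_add[OF blinfun_der has_derivative_const[of "lam *\<^sub>R (y - x)"]]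
      show ?thesis unfolding hess_def by simp
    qed
    fix z w
    have "norm (?D z w (y - x) - ?D x w (y - x)) = norm ((?D z - ?D x) w (y - x))"
      by (simp add: blinfun.diff_left)
    also have "\<dots> \<le> norm ((?D z - ?D x) w) * norm (y - x)" by (rule norm_blinfun)
    also have "\<dots> \<le> (norm (?D z - ?D x) * norm w) * norm (y - x)"
      by (intro mult_right_mono norm_blinfun) auto
    also have "\<dots> \<le> (Lh3 * norm (z - x) * norm w) * norm (y - x)"
      using lipschitz_onD[OF lip, of z x] by (intro mult_right_mono) (auto simp: dist_norm)
    finally show "norm (?D z w (y - x) - ?D x w (y - x)) \<le> Lh3 * norm (y - x) * norm (z - x) * norm w"
      by (simp add: mult_ac)
  qed
  then show ?thesis by (simp add: power2_eq_square power3_eq_cube)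
qed

lemma grad_f_taylor1:
  assumes fd: "grad f differentiable_on UNIV" and lip: "L2-lipschitz_on UNIV (fderiv (grad f))"
  shows "norm (grad f y - grad f x - fderiv (grad f) x (y - x)) \<le> L2 / 2 * (norm (y - x))\<^sup>2"
proof -
  have "norm (grad f y - grad f x - fderiv (grad f) x (y - x)) \<le> (L2 * norm (y - x)) / 2 * norm (y - x)"
  proof (rule taylor_order1)
    show "(grad f has_derivative blinfun_apply (fderiv (grad f) z)) (at z)" for z
      using fd by (intro has_derivative_fderiv) (simp add: differentiable_on_def)
    fix z
    have "norm (fderiv (grad f) z (y - x) - fderiv (grad f) x (y - x))
        \<le> norm (fderiv (grad f) z - fderiv (grad f) x) * norm (y - x)"
      by (metis blinfun.diff_left norm_blinfun)
    also have "\<dots> \<le> L2 * norm (z - x) * norm (y - x)"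
      using lipschitz_onD[OF lip, of z x] by (intro mult_right_mono) (auto simp: dist_norm)
    finally show "norm (fderiv (grad f) z (y - x) - fderiv (grad f) x (y - x)) \<le> L2 * norm (y - x) * norm (z - x)"
      by (simp add: mult_ac)
  qed
  then show ?thesis by (simp add: power2_eq_square)
qed

text \<open>When the second-order expansions at \<open>nu\<close> and \<open>- nu\<close> are
  subtracted, the quadratic terms form a difference of squares. It factors into the sum of the
  displacements, which is \<open>O(nu\<^sup>2)\<close> because their first-order parts cancel, and
  their difference, which is \<open>O(nu)\<close>. The Hessian of \<open>f\<close> acts on the same
  sum, with a factor \<open>nu\<close>. So everything left is cubic.\<close>

lemma phi_star_taylor2:
  assumes d2: "fderiv (grad fh) differentiable_on UNIV"
    and lip3: "Lh3-lipschitz_on UNIV (fderiv (fderiv (grad fh)))"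
    and fd: "grad f differentiable_on UNIV" and lip2: "L2-lipschitz_on UNIV (fderiv (grad f))"
    and w: "hess (phi_star f fh lam 0 \<theta>) w = grad f (phi_star f fh lam 0 \<theta>)" and nu: "nu > 0"
  shows "norm (phi_star f fh lam nu \<theta> - phi_star f fh lam (- nu) \<theta> + (2 * nu) *\<^sub>R w)
    \<le> 2 * nu ^ 3 / mu * (taylor_const mu L0 L1 Lh2 * (L1 + Lh2 * L0 / mu)
        + Lh3 * L0 ^ 3 / (6 * mu ^ 3) + L2 * L0\<^sup>2 / (2 * mu\<^sup>2))"
proof -
  let ?p = "phi_star f fh lam nu \<theta>" and ?m = "phi_star f fh lam (- nu) \<theta>"
    and ?q = "phi_star f fh lam 0 \<theta>"
  define D where "D = fderiv (fderiv (grad fh)) ?q"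
  define K where "K = fderiv (grad f) ?q"
  define T where "T = taylor_const mu L0 L1 Lh2"
  define e where "e = nu * L0 / mu"
  define r where "r y = (grad fh y + lam *\<^sub>R y) - (grad fh ?q + lam *\<^sub>R ?q) - hess ?q (y - ?q)
      - (1/2) *\<^sub>R D (y - ?q) (y - ?q)" for y
  define s where "s y = grad f y - grad f ?q - K (y - ?q)" for y
  define a where "a = (?p - ?q) + (?m - ?q)"
  have nn: "L0 \<ge> 0" "L1 \<ge> 0" "Lh2 \<ge> 0" "L2 \<ge> 0" "Lh3 \<ge> 0"
    using f_lip f_grad fh_hess lip2 lip3 lipschitz_on_nonneg by blast+
  have e: "norm (?p - ?q) \<le> e" "norm (?m - ?q) \<le> e"
    using phi_star_displacement[of nu \<theta>] phi_star_displacement[of "- nu" \<theta>] nu by (auto simp: e_def)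
  have D: "norm (D u v) \<le> Lh2 * norm u * norm v" for u v
  proof -
    have "(fderiv (grad fh) has_derivative blinfun_apply D) (at ?q)"
      unfolding D_def using d2 by (intro has_derivative_fderiv) (simp add: differentiable_on_def)
    from norm_has_derivative_le_lipschitz[OF this fh_hess]
    have "norm (D u) \<le> Lh2 * norm u" .
    then show ?thesis by (meson mult_right_mono norm_blinfun norm_ge_zero order_trans)
  qed
  have K: "norm (K u) \<le> L1 * norm u" for u
  proof -
    have "(grad f has_derivative blinfun_apply K) (at ?q)"
      unfolding K_def using fd by (intro has_derivative_fderiv) (simp add: differentiable_on_def)
    from norm_has_derivative_le_lipschitz[OF this f_grad] show ?thesis .
  qed
  have r: "norm (r y) \<le> Lh3 / 6 * e ^ 3" if "norm (y - ?q) \<le> e" for y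
  proof -
    have "norm (r y) \<le> Lh3 / 6 * (norm (y - ?q)) ^ 3"
      unfolding r_def D_def by (rule hess_taylor2[OF d2 lip3])
    also have "\<dots> \<le> Lh3 / 6 * e ^ 3" using that nn by (intro mult_left_mono power_mono) auto
    finally show ?thesis .
  qed
  have s: "norm (s y) \<le> L2 / 2 * e\<^sup>2" if "norm (y - ?q) \<le> e" for y
  proof -
    have "norm (s y) \<le> L2 / 2 * (norm (y - ?q))\<^sup>2"
      unfolding s_def K_def by (rule grad_f_taylor1[OF fd lip2])
    also have "\<dots> \<le> L2 / 2 * e\<^sup>2" using that nn by (intro mult_left_mono power_mono) auto
    finally show ?thesis .
  qed
  have a: "norm a \<le> 2 * nu\<^sup>2 * T"
  proof -
    have "a = (?p - ?q + nu *\<^sub>R w) + (?m - ?q + (- nu) *\<^sub>R w)" by (simp add: a_def)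
    also have "norm \<dots> \<le> nu\<^sup>2 * T + (- nu)\<^sup>2 * T"
      unfolding T_def by (intro norm_triangle_mono phi_star_taylor1[OF w])
    finally show ?thesis by (simp add: mult_ac)
  qed
  have pm: "norm (?p - ?m) \<le> 2 * e"
    using norm_triangle_ineq4[of "?p - ?q" "?m - ?q"] e by simp
  \<comment> \<open>Two cross terms, since \<open>D\<close> is not known to be symmetric.\<close>
  have polar: "D u u - D v v = (1/2) *\<^sub>R (D (u + v) (u - v) + D (u - v) (u + v))" for u v
  proof -
    have "D (u + v) (u - v) + D (u - v) (u + v) = 2 *\<^sub>R (D u u - D v v)"
      by (simp add: blinfun.add_left blinfun.add_right blinfun.diff_left blinfun.diff_right scaleR_2)
    then show ?thesis by simp
  qed
  have Dpm: "D (?p - ?q) (?p - ?q) - D (?m - ?q) (?m - ?q) = (1/2) *\<^sub>R (D a (?p - ?m) + D (?p - ?m) a)"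
    using polar[of "?p - ?q" "?m - ?q"] by (simp add: a_def)
  have "hess ?q (?p - ?m + (2 * nu) *\<^sub>R w) = hess ?q (?p - ?q) - hess ?q (?m - ?q) + (2 * nu) *\<^sub>R grad f ?q"
    by (simp add: linear_add[OF linear_hess] linear_diff[OF linear_hess] linear_scale[OF linear_hess] w)
  also have "\<dots> = - (nu *\<^sub>R K a + nu *\<^sub>R (s ?p + s ?m)
      + (1/2) *\<^sub>R (D (?p - ?q) (?p - ?q) - D (?m - ?q) (?m - ?q)) + (r ?p - r ?m))"
  proof -
    have "hess ?q (?p - ?q) = - (nu *\<^sub>R grad f ?p) - (1/2) *\<^sub>R D (?p - ?q) (?p - ?q) - r ?p"
      using phi_star_stationary[of nu \<theta>] phi_star_stationary[of 0 \<theta>]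
      by (simp add: r_def algebra_simps)
    moreover have "hess ?q (?m - ?q) = nu *\<^sub>R grad f ?m - (1/2) *\<^sub>R D (?m - ?q) (?m - ?q) - r ?m"
      using phi_star_stationary[of "- nu" \<theta>] phi_star_stationary[of 0 \<theta>]
      by (simp add: r_def algebra_simps)
    moreover have "K a = K (?p - ?q) + K (?m - ?q)" by (simp only: a_def blinfun.add_right)
    then have "nu *\<^sub>R K a + nu *\<^sub>R (s ?p + s ?m)
        = nu *\<^sub>R grad f ?p + nu *\<^sub>R grad f ?m - (2 * nu) *\<^sub>R grad f ?q"
      by (simp add: s_def algebra_simps scaleR_2[symmetric])
    ultimately show ?thesis by (simp add: scaleR_diff_right)
  qed
  finally have eq: "hess ?q (?p - ?m + (2 * nu) *\<^sub>R w) = - (nu *\<^sub>R K a + nu *\<^sub>R (s ?p + s ?m)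
      + (1/4) *\<^sub>R (D a (?p - ?m) + D (?p - ?m) a) + (r ?p - r ?m))"
    unfolding Dpm by simp
  have "mu * norm (?p - ?m + (2 * nu) *\<^sub>R w) \<le> norm (nu *\<^sub>R K a + nu *\<^sub>R (s ?p + s ?m)
      + (1/4) *\<^sub>R (D a (?p - ?m) + D (?p - ?m) a) + (r ?p - r ?m))"
    using hess_lower[of "?p - ?m + (2 * nu) *\<^sub>R w" ?q] unfolding eq norm_minus_cancel .
  \<comment> \<open>Each group is \<open>2 * nu ^ 3\<close> times one contribution to the bracket of
    the claim: the Hessian of \<open>f\<close> gives \<open>T * L1\<close>, the remainders
    \<open>s\<close> the \<open>L2\<close> term, \<open>D\<close> gives
    \<open>T * (Lh2 * L0 / mu)\<close>, and the remainders \<open>r\<close> the \<open>Lh3\<close>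
    term.\<close>
  also have "\<dots> \<le> nu * (L1 * (2 * nu\<^sup>2 * T)) + nu * (L2 / 2 * e\<^sup>2 + L2 / 2 * e\<^sup>2)
      + (1/4) * (Lh2 * (2 * nu\<^sup>2 * T) * (2 * e) + Lh2 * (2 * e) * (2 * nu\<^sup>2 * T))
      + (Lh3 / 6 * e ^ 3 + Lh3 / 6 * e ^ 3)"
  proof (intro norm_triangle_mono norm_triangle_le_diff)
    have T0: "0 \<le> 2 * nu\<^sup>2 * T" using a norm_ge_zero order_trans by blast
    have e0: "0 \<le> e" using e norm_ge_zero order_trans by blast
    have "norm (K a) \<le> L1 * (2 * nu\<^sup>2 * T)"
      using K[of a] a nn by (meson mult_left_mono order_trans)
    then show "norm (nu *\<^sub>R K a) \<le> nu * (L1 * (2 * nu\<^sup>2 * T))" using nu by simp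
    have "norm (s ?p + s ?m) \<le> L2 / 2 * e\<^sup>2 + L2 / 2 * e\<^sup>2"
      by (intro norm_triangle_mono s e)
    then show "norm (nu *\<^sub>R (s ?p + s ?m)) \<le> nu * (L2 / 2 * e\<^sup>2 + L2 / 2 * e\<^sup>2)" using nu by simp
    have "norm (D a (?p - ?m)) \<le> Lh2 * (2 * nu\<^sup>2 * T) * (2 * e)"
      using order_trans[OF D mult_mono[OF mult_left_mono[OF a nn(3)] pm]] nn T0 by simp
    moreover have "norm (D (?p - ?m) a) \<le> Lh2 * (2 * e) * (2 * nu\<^sup>2 * T)"
      using order_trans[OF D mult_mono[OF mult_left_mono[OF pm nn(3)] a]] nn e0 by simp
    ultimately have "norm (D a (?p - ?m) + D (?p - ?m) a)
        \<le> Lh2 * (2 * nu\<^sup>2 * T) * (2 * e) + Lh2 * (2 * e) * (2 * nu\<^sup>2 * T)"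
      by (rule norm_triangle_mono)
    then show "norm ((1/4) *\<^sub>R (D a (?p - ?m) + D (?p - ?m) a))
        \<le> (1/4) * (Lh2 * (2 * nu\<^sup>2 * T) * (2 * e) + Lh2 * (2 * e) * (2 * nu\<^sup>2 * T))"
      by simp
    show "norm (r ?p) + norm (r ?m) \<le> Lh3 / 6 * e ^ 3 + Lh3 / 6 * e ^ 3"
      by (intro add_mono r e)
  qed
  also have "\<dots> = mu * (2 * nu ^ 3 / mu * (T * (L1 + Lh2 * L0 / mu)
        + Lh3 * L0 ^ 3 / (6 * mu ^ 3) + L2 * L0\<^sup>2 / (2 * mu\<^sup>2)))"
    using mu unfolding e_def by (simp add: field_simps power2_eq_square power3_eq_cube)
  finally show ?thesis unfolding T_def mult_le_cancel_left_pos[OF mu] .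
qed

text \<open>The expansion error is now of order \<open>nu\<^sup>2\<close> against
  \<open>\<delta> / nu\<close> from the solver, which balances at \<open>nu\<close> of order
  \<open>\<delta> powr (1/3)\<close>.\<close>

lemma symmetric_est_error:
  assumes d2: "fderiv (grad fh) differentiable_on UNIV"
    and lip3: "Lh3-lipschitz_on UNIV (fderiv (fderiv (grad fh)))"
    and fd: "grad f differentiable_on UNIV" and lip2: "L2-lipschitz_on UNIV (fderiv (grad f))"
    and w: "hess (phi_star f fh lam 0 \<theta>) w = grad f (phi_star f fh lam 0 \<theta>)" and nu: "nu > 0"
    and p: "norm (p nu - phi_star f fh lam nu \<theta>) \<le> \<delta>"
      "norm (p (- nu) - phi_star f fh lam (- nu) \<theta>) \<le> \<delta>"
  shows "norm (symmetric_est lam nu p - lam *\<^sub>R w)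
    \<le> lam * (\<delta> / nu + nu\<^sup>2 / mu * (taylor_const mu L0 L1 Lh2 * (L1 + Lh2 * L0 / mu)
        + Lh3 * L0 ^ 3 / (6 * mu ^ 3) + L2 * L0\<^sup>2 / (2 * mu\<^sup>2)))" (is "_ \<le> lam * (_ + _ / _ * ?C)")
proof -
  let ?p = "phi_star f fh lam nu \<theta>" and ?m = "phi_star f fh lam (- nu) \<theta>"
  have "symmetric_est lam nu p - lam *\<^sub>R w
      = - ((lam / (2 * nu)) *\<^sub>R ((p nu - ?p) - (p (- nu) - ?m) + (?p - ?m + (2 * nu) *\<^sub>R w)))"
    using nu by (simp add: symmetric_est_def algebra_simps)
  then have "norm (symmetric_est lam nu p - lam *\<^sub>R w)
      = lam / (2 * nu) * norm ((p nu - ?p) - (p (- nu) - ?m) + (?p - ?m + (2 * nu) *\<^sub>R w))"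
    using lam nu by simp
  also have "\<dots> \<le> lam / (2 * nu) * (\<delta> + \<delta> + 2 * nu ^ 3 / mu * ?C)"
    using lam nu p phi_star_taylor2[OF d2 lip3 fd lip2 w nu]
    by (intro mult_left_mono norm_triangle_mono norm_triangle_le_diff) auto
  also have "\<dots> = lam * (\<delta> / nu + nu\<^sup>2 / mu * ?C)"
    using nu mu by (simp add: field_simps power2_eq_square power3_eq_cube)
  finally show ?thesis .
qed

text \<open>The estimator bounds are distances to \<open>lam *\<^sub>R w\<close>; this identifies
  that vector with the task gradient.\<close>

lemma grad_task_obj_eq:
  obtains w where "hess (phi_star f fh lam 0 \<theta>) w = grad f (phi_star f fh lam 0 \<theta>)"
    and "GDERIV (task_obj f fh lam) \<theta> :> grad (task_obj f fh lam) \<theta>"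
    and "grad (task_obj f fh lam) \<theta> = lam *\<^sub>R w"
proof -
  obtain k where "\<And>v. hess (phi_star f fh lam 0 \<theta>) (k v) = v"
    using hess_inverse by blast
  then have w: "hess (phi_star f fh lam 0 \<theta>) (k (grad f (phi_star f fh lam 0 \<theta>)))
      = grad f (phi_star f fh lam 0 \<theta>)" .
  show thesis using that[OF w] task_obj_GDERIV[OF w] grad_eqI by metis
qed

end

section \<open>Sampling mini-batches\<close>

text \<open>Removing \<open>T\<close> is a bijection onto the subsets of \<open>U - T\<close> with
  \<open>k - card T\<close> elements; adjoining \<open>T\<close> inverts it.\<close>

lemma card_subsets_containing:
  assumes "finite U" "T \<subseteq> U" "card T \<le> k"
  shows "card {S. S \<subseteq> U \<and> card S = k \<and> T \<subseteq> S} = (card U - card T) choose (k - card T)"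
proof -
  have fT: "finite T" using assms finite_subset by blast
  have "bij_betw (\<lambda>S. S - T) {S. S \<subseteq> U \<and> card S = k \<and> T \<subseteq> S}
      {R. R \<subseteq> U - T \<and> card R = k - card T}"
  proof (rule bij_betw_byWitness[where f' = "\<lambda>R. R \<union> T"])
    have "card (R \<union> T) = k" if "R \<subseteq> U - T" "card R = k - card T" for R
      using that assms fT finite_subset[of R U] by (subst card_Un_disjoint) auto
    then show "(\<lambda>R. R \<union> T) ` {R. R \<subseteq> U - T \<and> card R = k - card T}
        \<subseteq> {S. S \<subseteq> U \<and> card S = k \<and> T \<subseteq> S}"
      using assms by auto
  qed (use fT in \<open>auto simp: card_Diff_subset\<close>)
  then have "card {S. S \<subseteq> U \<and> card S = k \<and> T \<subseteq> S} = card {R. R \<subseteq> U - T \<and> card R = k - card T}"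
    by (rule bij_betw_same_card)
  also have "\<dots> = card (U - T) choose (k - card T)"
    using assms by (intro n_subsets) auto
  finally show ?thesis using assms fT by (simp add: card_Diff_subset)
qed

lemma finite_batches: "finite (batches M B)"
  unfolding batches_def by (rule finite_subset[of _ "Pow {..<M}"]) auto

lemma card_batches: "card (batches M B) = M choose B"
  unfolding batches_def using n_subsets[of "{..<M}" B] by simp

lemma batches_nonempty: "B \<le> M \<Longrightarrow> batches M B \<noteq> {}"
  using card_batches[of M B] by (metis card.empty zero_less_binomial less_irrefl)

lemma sum_batches_swap:
  fixes c :: "nat \<Rightarrow> 'b::real_vector"
  shows "(\<Sum>S\<in>batches M B. \<Sum>i\<in>S. c i)
    = (\<Sum>i<M. real (card {S \<in> batches M B. i \<in> S}) *\<^sub>R c i)"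
proof -
  have "(\<Sum>i\<in>S. c i) = (\<Sum>i<M. if i \<in> S then c i else 0)" if "S \<in> batches M B" for S
    using that sum.inter_restrict[of "{..<M}" c S] by (auto simp: batches_def Int_absorb1)
  then have "(\<Sum>S\<in>batches M B. \<Sum>i\<in>S. c i) = (\<Sum>S\<in>batches M B. \<Sum>i<M. if i \<in> S then c i else 0)"
    by simp
  also have "\<dots> = (\<Sum>i<M. \<Sum>S\<in>batches M B. if i \<in> S then c i else 0)" by (rule sum.swap)
  also have "\<dots> = (\<Sum>i<M. real (card {S \<in> batches M B. i \<in> S}) *\<^sub>R c i)"
    by (intro sum.cong refl)
      (simp add: sum.inter_filter[symmetric, OF finite_batches] sum_constant_scaleR)
  finally show ?thesis .
qed

text \<open>The inclusion probability \<open>B / M\<close> in a form without division; it is the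
  absorption identity for binomial coefficients.\<close>

lemma card_batches_containing:
  assumes "1 \<le> B" "B \<le> M" "i < M"
  shows "real M * real (card {S \<in> batches M B. i \<in> S}) = real B * real (card (batches M B))"
proof -
  have "{S \<in> batches M B. i \<in> S} = {S. S \<subseteq> {..<M} \<and> card S = B \<and> {i} \<subseteq> S}"
    by (auto simp: batches_def)
  then have "card {S \<in> batches M B. i \<in> S} = (M - 1) choose (B - 1)"
    using card_subsets_containing[of "{..<M}" "{i}" B] assms by simp
  moreover have "B * (M choose B) = M * ((M - 1) choose (B - 1))"
    using assms by (intro times_binomial_minus1_eq) auto
  ultimately show ?thesis by (metis card_batches of_nat_mult)
qed

text \<open>Given that \<open>i\<close> is in the batch, \<open>j\<close> is there with probability
  \<open>(B - 1) / (M - 1)\<close>: the rest of the batch is a uniform draw from the other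
  tasks.\<close>

lemma card_batches_containing2:
  assumes "1 \<le> B" "B \<le> M" "i < M" "j < M" "i \<noteq> j"
  shows "(real M - 1) * real (card {S \<in> batches M B. i \<in> S \<and> j \<in> S})
    = (real B - 1) * real (card {S \<in> batches M B. i \<in> S})"
\<comment> \<open>A pair does not fit into a batch of one task, and the counting lemma requires
  \<open>card {i, j} \<le> B\<close>.\<close>
proof (cases "B = 1")
  case True
  then have "{S \<in> batches M B. i \<in> S \<and> j \<in> S} = {}"
    using assms by (auto simp: batches_def card_1_singleton_iff)
  then have "card {S \<in> batches M B. i \<in> S \<and> j \<in> S} = 0" by (simp only: card.empty)
  then show ?thesis using True by simp
next
  case False
  have "{S \<in> batches M B. i \<in> S} = {S. S \<subseteq> {..<M} \<and> card S = B \<and> {i} \<subseteq> S}"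
    by (auto simp: batches_def)
  then have 1: "card {S \<in> batches M B. i \<in> S} = (M - 1) choose (B - 1)"
    using card_subsets_containing[of "{..<M}" "{i}" B] assms by simp
  have "{S \<in> batches M B. i \<in> S \<and> j \<in> S} = {S. S \<subseteq> {..<M} \<and> card S = B \<and> {i, j} \<subseteq> S}"
    by (auto simp: batches_def)
  then have 2: "card {S \<in> batches M B. i \<in> S \<and> j \<in> S} = (M - 2) choose (B - 2)"
    using card_subsets_containing[of "{..<M}" "{i, j}" B] assms False by (simp add: numeral_2_eq_2)
  have "(B - 1) * ((M - 1) choose (B - 1)) = (M - 1) * ((M - 1 - 1) choose (B - 1 - 1))"
    using assms False by (intro times_binomial_minus1_eq) auto
  then have "real (B - 1) * real ((M - 1) choose (B - 1)) = real (M - 1) * real ((M - 2) choose (B - 2))"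
    by (metis of_nat_mult diff_diff_left one_add_one)
  then show ?thesis using assms 1 2 by (simp add: of_nat_diff)
qed

lemma sum_batches_mean:
  fixes v :: "nat \<Rightarrow> 'a::real_vector"
  assumes "1 \<le> B" "B \<le> M"
  shows "(\<Sum>S\<in>batches M B. (1 / real B) *\<^sub>R (\<Sum>i\<in>S. v i))
    = real (card (batches M B)) *\<^sub>R ((1 / real M) *\<^sub>R (\<Sum>i<M. v i))"
proof -
  have c: "real (card {S \<in> batches M B. i \<in> S}) = real B * real (card (batches M B)) / real M"
    if "i < M" for i
    using card_batches_containing[OF assms that] assms by (simp add: field_simps)
  have "(\<Sum>S\<in>batches M B. \<Sum>i\<in>S. v i)
      = (real B * real (card (batches M B)) / real M) *\<^sub>R (\<Sum>i<M. v i)"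
    by (simp add: sum_batches_swap c scaleR_sum_right)
  then show ?thesis using assms by (simp add: scaleR_sum_right[symmetric])
qed

text \<open>Sampling without replacement gives the exact factor \<open>(M - B) / ((M - 1) B)\<close>; the 2 pays for
  replacing \<open>M - 1\<close> by \<open>M\<close>.\<close>

lemma sum_batches_variance:
  fixes v :: "nat \<Rightarrow> 'a::real_inner"
  assumes "1 \<le> B" "B \<le> M" and v0: "(\<Sum>i<M. v i) = 0"
  shows "(\<Sum>S\<in>batches M B. (norm ((1 / real B) *\<^sub>R (\<Sum>i\<in>S. v i)))\<^sup>2)
    \<le> real (card (batches M B)) * (2 * ((real M - real B) / (real M * real B) * (1 / real M * (\<Sum>i<M. (norm (v i))\<^sup>2))))"
\<comment> \<open>With a single task \<open>v 0 = 0\<close>, so both sides vanish; otherwise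
  division by \<open>M - 1\<close> is meaningful.\<close>
proof (cases "M = 1")
  case True
  then have "B = 1" using assms by simp
  have "v 0 = 0" using v0 True by simp
  have "S = {0}" if "S \<in> batches M B" for S
    using that True \<open>B = 1\<close> by (auto simp: batches_def card_1_singleton_iff)
  then have "norm ((1 / real B) *\<^sub>R (\<Sum>i\<in>S. v i)) = 0" if "S \<in> batches M B" for S
    using that \<open>v 0 = 0\<close> by fastforce
  then show ?thesis using True \<open>B = 1\<close> by simp
next
  case False
  then have M: "M \<ge> 2" using assms by simp
  define N where "N = real (card (batches M B))"
  \<comment> \<open>\<open>a\<close> and \<open>p\<close> count the batches that contain a given
    task and a given pair of tasks.\<close>
  define a where "a = real B * N / real M"
  define p where "p = (real B - 1) * a / (real M - 1)"
  define Q where "Q = (\<Sum>i<M. (norm (v i))\<^sup>2)"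
  have Q0: "Q \<ge> 0" unfolding Q_def by (intro sum_nonneg) auto
  have a: "real (card {S \<in> batches M B. i \<in> S}) = a" if "i < M" for i
    using card_batches_containing[of B M i] that assms by (simp add: field_simps a_def N_def)
  have p: "real (card {S \<in> batches M B. i \<in> S \<and> j \<in> S}) = p" if "i < M" "j < M" "i \<noteq> j" for i j
    using card_batches_containing2[of B M i j] that assms M a[of i] by (simp add: field_simps p_def)
  have sq: "(norm (\<Sum>i\<in>S. v i))\<^sup>2 = (\<Sum>i<M. \<Sum>j<M. (if i \<in> S \<and> j \<in> S then 1 else 0) * (v i \<bullet> v j))"
    if "S \<in> batches M B" for S
  proof -
    have "(\<Sum>i\<in>S. v i) = (\<Sum>i<M. if i \<in> S then v i else 0)"
      using that sum.inter_restrict[of "{..<M}" v S] by (auto simp: batches_def Int_absorb1)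
    then have "(norm (\<Sum>i\<in>S. v i))\<^sup>2
        = (\<Sum>i<M. \<Sum>j<M. (if i \<in> S then v i else 0) \<bullet> (if j \<in> S then v j else 0))"
      by (simp add: power2_norm_eq_inner inner_sum_left inner_sum_right) (rule sum.swap)
    also have "\<dots> = (\<Sum>i<M. \<Sum>j<M. (if i \<in> S \<and> j \<in> S then 1 else 0) * (v i \<bullet> v j))"
      by (intro sum.cong refl) auto
    finally show ?thesis .
  qed
  \<comment> \<open>Give every column the weight \<open>p\<close> and correct the diagonal by
    \<open>a - p\<close>: the uniform part is an inner product with the sum of all
    \<open>v j\<close>, which is zero.\<close>
  have row: "(\<Sum>j<M. real (card {S \<in> batches M B. i \<in> S \<and> j \<in> S}) * (v i \<bullet> v j)) = (a - p) * (norm (v i))\<^sup>2"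
    if "i < M" for i
  proof -
    have "(\<Sum>j<M. real (card {S \<in> batches M B. i \<in> S \<and> j \<in> S}) * (v i \<bullet> v j))
        = (\<Sum>j<M. p * (v i \<bullet> v j) + (if j = i then (a - p) * (v i \<bullet> v i) else 0))"
      using that by (intro sum.cong refl) (auto simp: a p algebra_simps)
    also have "\<dots> = p * (v i \<bullet> (\<Sum>j<M. v j)) + (a - p) * (v i \<bullet> v i)"
      using that by (simp add: sum.distrib sum_distrib_left inner_sum_right)
    finally show ?thesis by (simp add: v0 power2_norm_eq_inner)
  qed
  have "(\<Sum>S\<in>batches M B. (norm (\<Sum>i\<in>S. v i))\<^sup>2)
      = (\<Sum>S\<in>batches M B. \<Sum>i<M. \<Sum>j<M. (if i \<in> S \<and> j \<in> S then 1 else 0) * (v i \<bullet> v j))"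
    by (intro sum.cong refl sq)
  also have "\<dots> = (\<Sum>i<M. \<Sum>j<M. \<Sum>S\<in>batches M B. (if i \<in> S \<and> j \<in> S then 1 else 0) * (v i \<bullet> v j))"
    by (subst sum.swap, intro sum.cong refl, rule sum.swap)
  also have "\<dots> = (\<Sum>i<M. \<Sum>j<M. real (card {S \<in> batches M B. i \<in> S \<and> j \<in> S}) * (v i \<bullet> v j))"
    by (intro sum.cong refl)
      (simp add: sum_distrib_right[symmetric] sum.inter_filter[symmetric, OF finite_batches])
  also have "\<dots> = (a - p) * Q"
    unfolding Q_def sum_distrib_left by (intro sum.cong refl) (simp add: row)
  finally have tot: "(\<Sum>S\<in>batches M B. (norm (\<Sum>i\<in>S. v i))\<^sup>2) = (a - p) * Q" .
  have "(\<Sum>S\<in>batches M B. (norm ((1 / real B) *\<^sub>R (\<Sum>i\<in>S. v i)))\<^sup>2)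
      = (1 / real B)\<^sup>2 * (\<Sum>S\<in>batches M B. (norm (\<Sum>i\<in>S. v i))\<^sup>2)"
    by (simp add: power_mult_distrib power_divide sum_distrib_left)
  also have "\<dots> = (N * (real M - real B) * (1 / real M * Q) / real B) * (1 / (real M - 1))"
  proof -
    have "a - p = a * (real M - real B) / (real M - 1)"
      using M by (simp add: p_def field_simps)
    then show ?thesis unfolding tot using assms M
      by (simp add: a_def power2_eq_square mult_ac)
  qed
  also have "\<dots> \<le> (N * (real M - real B) * (1 / real M * Q) / real B) * (2 / real M)"
  proof (rule mult_left_mono)
    show "1 / (real M - 1) \<le> 2 / real M" using M by (simp add: field_simps)
    show "0 \<le> N * (real M - real B) * (1 / real M * Q) / real B"
      using assms Q0 by (intro divide_nonneg_nonneg mult_nonneg_nonneg) (auto simp: N_def)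
  qed
  finally show ?thesis by (simp add: N_def Q_def mult_ac)
qed

section \<open>Expectations over batch histories\<close>

definition history_expectation :: "nat \<Rightarrow> nat \<Rightarrow> nat \<Rightarrow> (nat set list \<Rightarrow> real) \<Rightarrow> real" where
  "history_expectation M B t \<phi> = measure_pmf.expectation (batch_histories M B t) \<phi>"

lemma history_expectation_eq_sum:
  assumes "B \<le> M"
  shows "history_expectation M B t \<phi>
    = (\<Sum>h | set h \<subseteq> batches M B \<and> length h = t. \<phi> h) / real (card (batches M B)) ^ t"
proof -
  have *: "{h. length h = t \<and> set h \<subseteq> batches M B} = {h. set h \<subseteq> batches M B \<and> length h = t}"
    by auto
  have fin: "finite {h. set h \<subseteq> batches M B \<and> length h = t}"
    by (rule finite_lists_length_eq[OF finite_batches])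
  have card: "card {h. set h \<subseteq> batches M B \<and> length h = t} = card (batches M B) ^ t"
    by (rule card_lists_length_eq[OF finite_batches])
  then have "{h. set h \<subseteq> batches M B \<and> length h = t} \<noteq> {}"
    using batches_nonempty[OF assms] finite_batches by (metis card.empty card_eq_0_iff power_not_zero)
  then show ?thesis
    using fin card unfolding history_expectation_def batch_histories_def * by (simp add: integral_pmf_of_set)
qed

lemma history_expectation_0: "B \<le> M \<Longrightarrow> history_expectation M B 0 \<phi> = \<phi> []"
  by (simp add: history_expectation_eq_sum cong: conj_cong)

text \<open>Tower rule: given the history \<open>h\<close>, the newest batch, which stands at the
  head of the list, is uniform.\<close>

lemma history_expectation_Suc:
  assumes "B \<le> M"
  shows "history_expectation M B (Suc t) \<phi>
    = history_expectation M B t (\<lambda>h. (\<Sum>S\<in>batches M B. \<phi> (S # h)) / real (card (batches M B)))"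
proof -
  have inj: "inj_on (\<lambda>(h, S). S # h) X" for X :: "(nat set list \<times> nat set) set"
    by (auto simp: inj_on_def)
  have comp: "\<phi> \<circ> (\<lambda>(h, S). S # h) = (\<lambda>(h, S). \<phi> (S # h))" by auto
  show ?thesis
    unfolding history_expectation_eq_sum[OF assms] lists_length_Suc_eq sum.reindex[OF inj]
    by (simp add: comp sum.cartesian_product[symmetric] sum_divide_distrib mult_ac)
qed

lemma history_expectation_mono:
  assumes "B \<le> M" "\<And>h. \<phi> h \<le> \<psi> h"
  shows "history_expectation M B t \<phi> \<le> history_expectation M B t \<psi>"
  unfolding history_expectation_eq_sum[OF assms(1)] using assms(2) by (intro divide_right_mono sum_mono) auto

lemma history_expectation_affine:
  assumes "B \<le> M"
  shows "history_expectation M B t (\<lambda>h. \<phi> h - c * \<psi> h + d) = history_expectation M B t \<phi> - c * history_expectation M B t \<psi> + d"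
proof -
  have "card (batches M B) > 0"
    using batches_nonempty[OF assms] finite_batches by (simp add: card_gt_0_iff)
  then show ?thesis
    unfolding history_expectation_eq_sum[OF assms]
    by (simp add: sum.distrib sum_subtractf sum_distrib_left[symmetric] add_divide_distrib
        diff_divide_distrib card_lists_length_eq[OF finite_batches])
qed

section \<open>Stochastic gradient descent with a biased estimator\<close>

text \<open>\<open>m S\<close> is meant as the average of exact gradients over the batch
  \<open>S\<close>, and \<open>v S\<close> as its estimate. Mean and variance are known only for
  \<open>m\<close>; the error enters pointwise, once linearly through Cauchy-Schwarz and once as
  \<open>b\<^sup>2\<close> through \<open>(norm (v S))\<^sup>2\<close>.\<close>

lemma sum_biased_gradient_step:
  fixes F :: "'a::real_inner \<Rightarrow> real"
  assumes desc: "\<And>d. F (x + d) \<le> F x + d \<bullet> g + L / 2 * (norm d)\<^sup>2"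
    and L: "L > 0" and b: "b \<ge> 0" and \<alpha>: "\<alpha> \<ge> 0"
    and mean: "(\<Sum>S\<in>X. m S) = real (card X) *\<^sub>R g"
    and var: "(\<Sum>S\<in>X. (norm (m S - g))\<^sup>2) \<le> real (card X) * s2"
    and err: "\<And>S. S \<in> X \<Longrightarrow> norm (v S - m S) \<le> b"
  shows "(\<Sum>S\<in>X. F (x - (\<alpha> / L) *\<^sub>R v S))
    \<le> real (card X) * (F x - \<alpha> / L * ((1 - \<alpha>) * (norm g)\<^sup>2 - b * norm g - \<alpha> * (s2 + b\<^sup>2)))"
proof -
  define \<eta> where "\<eta> = \<alpha> / L"
  have \<eta>: "\<eta> \<ge> 0" "L * \<eta> = \<alpha>" using L \<alpha> by (auto simp: \<eta>_def)
  \<comment> \<open>Arranged so that the batch enters only through \<open>m S \<bullet> g\<close>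
    and \<open>(norm (m S - g))\<^sup>2\<close>, whose sums are controlled by \<open>mean\<close>
    and \<open>var\<close>.\<close>
  have pt: "F (x - \<eta> *\<^sub>R v S) \<le> (F x + \<eta> * b * norm g + \<eta> * \<alpha> * (b\<^sup>2 - (norm g)\<^sup>2))
      + (2 * \<eta> * \<alpha> - \<eta>) * (m S \<bullet> g) + \<eta> * \<alpha> * (norm (m S - g))\<^sup>2" if "S \<in> X" for S
  proof -
    have 1: "m S \<bullet> g - b * norm g \<le> v S \<bullet> g"
    proof -
      have "\<bar>(v S - m S) \<bullet> g\<bar> \<le> b * norm g"
        using Cauchy_Schwarz_ineq2[of "v S - m S" g] err[OF that]
        by (meson mult_right_mono norm_ge_zero order_trans)
      then show ?thesis by (simp add: inner_diff_left abs_le_iff)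
    qed
    have 2: "(norm (v S))\<^sup>2 \<le> 2 * (norm (m S))\<^sup>2 + 2 * b\<^sup>2"
    proof -
      have "norm (v S) \<le> norm (m S) + b"
        using norm_triangle_sub[of "v S" "m S"] err[OF that] by simp
      then have "(norm (v S))\<^sup>2 \<le> (norm (m S) + b)\<^sup>2" by (simp add: power_mono)
      also have "\<dots> \<le> 2 * (norm (m S))\<^sup>2 + 2 * b\<^sup>2"
        using zero_le_power2[of "norm (m S) - b"] by (simp add: power2_sum power2_diff)
      finally show ?thesis .
    qed
    have 3: "(norm (m S))\<^sup>2 = (norm (m S - g))\<^sup>2 + 2 * (m S \<bullet> g) - (norm g)\<^sup>2"
      by (simp add: power2_norm_eq_inner inner_diff inner_commute)
    have "F (x - \<eta> *\<^sub>R v S) \<le> F x - \<eta> * (v S \<bullet> g) + \<eta> * \<alpha> / 2 * (norm (v S))\<^sup>2"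
      using desc[of "- \<eta> *\<^sub>R v S"] unfolding \<eta>(2)[symmetric]
      by (simp add: power_mult_distrib power2_eq_square mult_ac)
    also have "\<dots> \<le> F x - \<eta> * (m S \<bullet> g - b * norm g) + \<eta> * \<alpha> / 2 * (2 * (norm (m S))\<^sup>2 + 2 * b\<^sup>2)"
      using 1 2 \<eta> \<alpha> by (intro add_mono diff_mono mult_left_mono) auto
    also have "\<dots> = (F x + \<eta> * b * norm g + \<eta> * \<alpha> * (b\<^sup>2 - (norm g)\<^sup>2))
      + (2 * \<eta> * \<alpha> - \<eta>) * (m S \<bullet> g) + \<eta> * \<alpha> * (norm (m S - g))\<^sup>2"
      unfolding 3 by (simp add: algebra_simps)
    finally show ?thesis .
  qed
  have gm: "(\<Sum>S\<in>X. m S \<bullet> g) = real (card X) * (norm g)\<^sup>2"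
    using mean by (simp add: inner_sum_left[symmetric] power2_norm_eq_inner)
  have "(\<Sum>S\<in>X. F (x - \<eta> *\<^sub>R v S)) \<le> (\<Sum>S\<in>X. (F x + \<eta> * b * norm g + \<eta> * \<alpha> * (b\<^sup>2 - (norm g)\<^sup>2))
      + (2 * \<eta> * \<alpha> - \<eta>) * (m S \<bullet> g) + \<eta> * \<alpha> * (norm (m S - g))\<^sup>2)"
    by (intro sum_mono pt)
  also have "\<dots> = real (card X) * (F x + \<eta> * b * norm g + \<eta> * \<alpha> * (b\<^sup>2 - (norm g)\<^sup>2))
      + (2 * \<eta> * \<alpha> - \<eta>) * (real (card X) * (norm g)\<^sup>2) + \<eta> * \<alpha> * (\<Sum>S\<in>X. (norm (m S - g))\<^sup>2)"
    by (simp add: gm sum.distrib sum_distrib_left[symmetric])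
  also have "\<dots> \<le> real (card X) * (F x + \<eta> * b * norm g + \<eta> * \<alpha> * (b\<^sup>2 - (norm g)\<^sup>2))
      + (2 * \<eta> * \<alpha> - \<eta>) * (real (card X) * (norm g)\<^sup>2) + \<eta> * \<alpha> * (real (card X) * s2)"
    using var \<eta> \<alpha> by (intro add_left_mono mult_left_mono) auto
  also have "\<dots> = real (card X) * (F x - \<eta> * ((1 - \<alpha>) * (norm g)\<^sup>2 - b * norm g - \<alpha> * (s2 + b\<^sup>2)))"
    by (simp add: algebra_simps)
  finally show ?thesis unfolding \<eta>_def .
qed

theorem biased_sgd_convergence:
  fixes F :: "'a::real_inner \<Rightarrow> real" and start :: "'a" and v :: "nat \<Rightarrow> 'a \<Rightarrow> 'a" and B M :: nat
  assumes batch: "1 \<le> B" "B \<le> M" and L: "L > 0" and b: "b \<ge> 0" and \<epsilon>: "\<epsilon> > 0"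
    and der: "\<And>x. GDERIV F x :> G x"
    and lip: "\<And>x y. norm (G x - G y) \<le> L * norm (x - y)"
    and low: "\<And>x. Fstar \<le> F x"
    and mean: "\<And>x. G x = (1 / real M) *\<^sub>R (\<Sum>i<M. v i x)"
    and sim: "\<And>x. 1 / real M * (\<Sum>i<M. (norm (v i x - G x))\<^sup>2) \<le> zeta\<^sup>2"
    and err: "\<And>h i x. i < M \<Longrightarrow> norm (est (\<lambda>nu. sol h i nu x) - v i x) \<le> b"
  defines "\<Delta> \<equiv> F start - Fstar"
    and "sigma2 \<equiv> (real M - real B) / (real M * real B) * zeta\<^sup>2"
  shows "\<exists>eta>0. \<exists>t::nat. real t \<le> step_const * (L * \<Delta> / \<epsilon>\<^sup>2 + L * \<Delta> * sigma2 / \<epsilon> ^ 4)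
    \<and> history_expectation M B t (\<lambda>h. norm (G (sgd_iterate est sol B eta start h))) \<le> \<epsilon> + b"
proof -
  define R where "R = step_const * (L * \<Delta> / \<epsilon>\<^sup>2 + L * \<Delta> * sigma2 / \<epsilon> ^ 4)"
  define u where "u = b + \<epsilon>"
  \<comment> \<open>Maximises the guaranteed decrease \<open>\<alpha> (\<epsilon> u - 2 \<alpha> (u\<^sup>2 + sigma2))\<close> at gradient norm \<open>u\<close>.\<close>
  define \<alpha> where "\<alpha> = \<epsilon> * u / (4 * (u\<^sup>2 + sigma2))"
  define x where "x = sgd_iterate est sol B (\<alpha> / L) start"
  define N where "N = real (card (batches M B))"
  have N: "N > 0" using batches_nonempty[OF batch(2)] finite_batches by (simp add: N_def card_gt_0_iff)
  have u: "u > 0" "\<epsilon> \<le> u" "b \<le> u" using b \<epsilon> by (auto simp: u_def)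
  have \<sigma>: "sigma2 \<ge> 0" unfolding sigma2_def using batch by simp
  have \<Delta>: "\<Delta> \<ge> 0" using low by (simp add: \<Delta>_def)
  have us: "u\<^sup>2 + sigma2 > 0" using u \<sigma> by (simp add: add_pos_nonneg)
  have \<alpha>: "\<alpha> > 0" using u \<epsilon> us by (simp add: \<alpha>_def)
  have \<alpha>4: "\<alpha> \<le> 1 / 4"
  proof -
    have "\<epsilon> * u \<le> u\<^sup>2 + sigma2" using u \<sigma> \<epsilon> by (simp add: power2_eq_square add_increasing2)
    then show ?thesis using us by (simp add: \<alpha>_def field_simps)
  qed
  have \<alpha>_eq: "\<alpha> * (2 * u\<^sup>2 + 2 * sigma2) = \<epsilon> * u / 2"
    using us by (simp add: \<alpha>_def field_simps)
  \<comment> \<open>The coefficient of the gradient norm once its square is replaced by the tangent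
    at \<open>u\<close>; since it is nonnegative, the expected norm can be replaced by its lower
    bound \<open>u\<close>.\<close>
  define k where "k = 2 * (1 - \<alpha>) * u - b"
  have k: "k \<ge> 0"
  proof -
    have "2 * (1 - \<alpha>) * u \<ge> 1 * u" using \<alpha>4 u by (intro mult_right_mono) auto
    then show ?thesis unfolding k_def using u by linarith
  qed
  \<comment> \<open>The terms without \<alpha> add up to \<open>\<epsilon> * u\<close>; the choice
    of \<alpha> keeps the others at no more than half of that.\<close>
  have gain: "k * u - (1 - \<alpha>) * u\<^sup>2 - \<alpha> * (2 * sigma2 + b\<^sup>2) \<ge> \<epsilon> * u / 2"
  proof -
    have "b\<^sup>2 \<le> u\<^sup>2" using u b by (simp add: power_mono)
    then have "\<alpha> * (u\<^sup>2 + 2 * sigma2 + b\<^sup>2) \<le> \<alpha> * (2 * u\<^sup>2 + 2 * sigma2)"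
      using \<alpha> by (intro mult_left_mono) auto
    then have "\<alpha> * (u\<^sup>2 + 2 * sigma2 + b\<^sup>2) \<le> \<epsilon> * u / 2" by (simp only: \<alpha>_eq)
    moreover have "k * u - (1 - \<alpha>) * u\<^sup>2 - \<alpha> * (2 * sigma2 + b\<^sup>2)
        = \<epsilon> * u - \<alpha> * (u\<^sup>2 + 2 * sigma2 + b\<^sup>2)"
      by (simp add: k_def u_def power2_eq_square algebra_simps)
    ultimately show ?thesis by simp
  qed
  \<comment> \<open>Descent conditional on the history \<open>h\<close>, averaged over the next
    batch. The variance appears as \<open>2 * sigma2\<close>, the 2 coming from
    \<open>sum_batches_variance\<close>.\<close>
  have step: "(\<Sum>S\<in>batches M B. F (x (S # h))) / N
      \<le> F (x h) - (\<alpha> / L * k) * norm (G (x h)) + \<alpha> / L * ((1 - \<alpha>) * u\<^sup>2 + \<alpha> * (2 * sigma2 + b\<^sup>2))" for h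
  proof -
    let ?y = "x h" and ?m = "\<lambda>S. (1 / real B) *\<^sub>R (\<Sum>i\<in>S. v i (x h))"
    have B: "card S = B" "S \<subseteq> {..<M}" if "S \<in> batches M B" for S
      using that by (auto simp: batches_def)
    have md: "?m S - G ?y = (1 / real B) *\<^sub>R (\<Sum>i\<in>S. v i ?y - G ?y)" if "S \<in> batches M B" for S
      using B[OF that] batch by (simp add: sum_subtractf scaleR_diff_right sum_constant_scaleR)
    have "(\<Sum>S\<in>batches M B. F (?y - (\<alpha> / L) *\<^sub>R ((1 / real B) *\<^sub>R (\<Sum>i\<in>S. est (\<lambda>nu. sol (S # h) i nu ?y)))))
      \<le> real (card (batches M B)) * (F ?y - \<alpha> / L * ((1 - \<alpha>) * (norm (G ?y))\<^sup>2
          - b * norm (G ?y) - \<alpha> * (2 * sigma2 + b\<^sup>2)))"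
    proof (rule sum_biased_gradient_step[where m = ?m])
      show "F (?y + d) \<le> F ?y + d \<bullet> G ?y + L / 2 * (norm d)\<^sup>2" for d
        by (rule lipschitz_gradient_descent[OF der lip])
      show "sum ?m (batches M B) = real (card (batches M B)) *\<^sub>R G ?y"
        unfolding mean by (rule sum_batches_mean[OF batch])
      have "(\<Sum>i<M. v i ?y - G ?y) = 0"
        using batch mean[of ?y] by (simp add: sum_subtractf sum_constant_scaleR)
      from sum_batches_variance[OF batch this]
      have "(\<Sum>S\<in>batches M B. (norm (?m S - G ?y))\<^sup>2) \<le> N * (2 * ((real M - real B) / (real M * real B)
          * (1 / real M * (\<Sum>i<M. (norm (v i ?y - G ?y))\<^sup>2))))"
        by (simp add: md N_def)
      also have "\<dots> \<le> N * (2 * sigma2)"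
        unfolding sigma2_def using batch N sim[of ?y] by (intro mult_left_mono) auto
      finally show "(\<Sum>S\<in>batches M B. (norm (?m S - G ?y))\<^sup>2) \<le> real (card (batches M B)) * (2 * sigma2)"
        by (simp only: N_def)
      fix S assume S: "S \<in> batches M B"
      have "norm ((1 / real B) *\<^sub>R (\<Sum>i\<in>S. est (\<lambda>nu. sol (S # h) i nu ?y)) - ?m S)
          = 1 / real B * norm (\<Sum>i\<in>S. est (\<lambda>nu. sol (S # h) i nu ?y) - v i ?y)"
        by (simp add: sum_subtractf scaleR_diff_right[symmetric])
      also have "\<dots> \<le> 1 / real B * (\<Sum>i\<in>S. b)"
        using B[OF S] by (intro mult_left_mono sum_norm_le err) auto
      also have "\<dots> = b" using B[OF S] batch by simp
      finally show "norm ((1 / real B) *\<^sub>R (\<Sum>i\<in>S. est (\<lambda>nu. sol (S # h) i nu ?y)) - ?m S) \<le> b" .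
    qed (use L b \<alpha> in auto)
    then have "(\<Sum>S\<in>batches M B. F (x (S # h))) \<le> N * (F ?y - \<alpha> / L * ((1 - \<alpha>) * (norm (G ?y))\<^sup>2
          - b * norm (G ?y) - \<alpha> * (2 * sigma2 + b\<^sup>2)))"
      by (simp add: x_def N_def Let_def)
    then have 1: "(\<Sum>S\<in>batches M B. F (x (S # h))) / N \<le> F ?y - \<alpha> / L * ((1 - \<alpha>) * (norm (G ?y))\<^sup>2
          - b * norm (G ?y) - \<alpha> * (2 * sigma2 + b\<^sup>2))"
      using N by (simp add: pos_divide_le_eq mult.commute)
    \<comment> \<open>Linearising the square at \<open>u\<close> lets the expectation be taken without Jensen's inequality.\<close>
    have "(norm (G ?y))\<^sup>2 \<ge> 2 * u * norm (G ?y) - u\<^sup>2"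
      using zero_le_power2[of "norm (G ?y) - u"] by (simp add: power2_diff mult_ac)
    then have "(1 - \<alpha>) * (norm (G ?y))\<^sup>2 \<ge> (1 - \<alpha>) * (2 * u * norm (G ?y) - u\<^sup>2)"
      using \<alpha>4 by (intro mult_left_mono) auto
    then have "\<alpha> / L * ((1 - \<alpha>) * (norm (G ?y))\<^sup>2 - b * norm (G ?y) - \<alpha> * (2 * sigma2 + b\<^sup>2))
      \<ge> \<alpha> / L * ((1 - \<alpha>) * (2 * u * norm (G ?y) - u\<^sup>2) - b * norm (G ?y) - \<alpha> * (2 * sigma2 + b\<^sup>2))"
      using \<alpha> L by (intro mult_left_mono) auto
    also have "\<alpha> / L * ((1 - \<alpha>) * (2 * u * norm (G ?y) - u\<^sup>2) - b * norm (G ?y) - \<alpha> * (2 * sigma2 + b\<^sup>2))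
      = (\<alpha> / L * k) * norm (G ?y) - \<alpha> / L * ((1 - \<alpha>) * u\<^sup>2 + \<alpha> * (2 * sigma2 + b\<^sup>2))"
      by (simp only: k_def algebra_simps)
    finally show ?thesis using 1 by linarith
  qed
  have descent: "history_expectation M B (Suc t) (\<lambda>h. F (x h)) \<le> history_expectation M B t (\<lambda>h. F (x h)) - \<alpha> / L * (\<epsilon> * u / 2)"
    if "history_expectation M B t (\<lambda>h. norm (G (x h))) \<ge> u" for t
  proof -
    let ?q = "history_expectation M B t (\<lambda>h. norm (G (x h)))"
    have "history_expectation M B (Suc t) (\<lambda>h. F (x h)) \<le> history_expectation M B t (\<lambda>h. F (x h) - (\<alpha> / L * k) * norm (G (x h))
        + \<alpha> / L * ((1 - \<alpha>) * u\<^sup>2 + \<alpha> * (2 * sigma2 + b\<^sup>2)))"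
      unfolding history_expectation_Suc[OF batch(2)] using step by (intro history_expectation_mono[OF batch(2)]) (simp add: N_def)
    also have "\<dots> = history_expectation M B t (\<lambda>h. F (x h)) - (\<alpha> / L * k) * ?q
        + \<alpha> / L * ((1 - \<alpha>) * u\<^sup>2 + \<alpha> * (2 * sigma2 + b\<^sup>2))"
      by (rule history_expectation_affine[OF batch(2)])
    also have "\<dots> \<le> history_expectation M B t (\<lambda>h. F (x h)) - (\<alpha> / L * k) * u
        + \<alpha> / L * ((1 - \<alpha>) * u\<^sup>2 + \<alpha> * (2 * sigma2 + b\<^sup>2))"
      using that k \<alpha> L by (intro add_right_mono diff_left_mono mult_left_mono) auto
    also have "\<dots> = history_expectation M B t (\<lambda>h. F (x h))
        - \<alpha> / L * (k * u - (1 - \<alpha>) * u\<^sup>2 - \<alpha> * (2 * sigma2 + b\<^sup>2))"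
      by (simp only: algebra_simps)
    also have "\<dots> \<le> history_expectation M B t (\<lambda>h. F (x h)) - \<alpha> / L * (\<epsilon> * u / 2)"
      using gain \<alpha> L by (intro diff_left_mono mult_left_mono) auto
    finally show ?thesis .
  qed
  have "\<exists>t. real t \<le> R \<and> history_expectation M B t (\<lambda>h. norm (G (x h))) \<le> u"
  proof (rule ccontr)
    assume contra: "\<not> ?thesis"
    define c where "c = \<alpha> / L * (\<epsilon> * u / 2)"
    have c: "c > 0" using \<alpha> L \<epsilon> u by (simp add: c_def)
    \<comment> \<open>The least natural number above \<open>R\<close>: every \<open>t\<close> before
      it satisfies \<open>real t \<le> R\<close>, so under the contrary assumption all
      \<open>T\<close> steps are descent steps.\<close>
    define T where "T = nat \<lfloor>R\<rfloor> + 1"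
    have R0: "R \<ge> 0" unfolding R_def step_const_def using L \<Delta> \<sigma> \<epsilon> by simp
    then have T: "real T > R" unfolding T_def by linarith
    have "history_expectation M B t (\<lambda>h. F (x h)) \<le> F start - real t * c" if "t \<le> T" for t
      using that
    proof (induction t)
      case 0
      then show ?case by (simp add: history_expectation_0[OF batch(2)] x_def)
    next
      case (Suc t)
      then have "real t \<le> real_of_int \<lfloor>R\<rfloor>" using R0 unfolding T_def by linarith
      then have "real t \<le> R" using of_int_floor_le order_trans by blast
      then have "history_expectation M B t (\<lambda>h. norm (G (x h))) \<ge> u" using contra by force
      then have "history_expectation M B (Suc t) (\<lambda>h. F (x h)) \<le> history_expectation M B t (\<lambda>h. F (x h)) - c"
        unfolding c_def by (rule descent)
      then show ?case using Suc by (simp add: algebra_simps)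
    qed
    from this[of T] have "history_expectation M B T (\<lambda>h. F (x h)) \<le> F start - real T * c" by simp
    moreover have "Fstar \<le> history_expectation M B T (\<lambda>h. F (x h))"
    proof -
      \<comment> \<open>The constant \<open>Fstar\<close> is written in the shape of
        \<open>history_expectation_affine\<close>, which then evaluates its expectation.\<close>
      have "history_expectation M B T (\<lambda>h. 0 - 0 * 0 + Fstar) \<le> history_expectation M B T (\<lambda>h. F (x h))"
        using low by (intro history_expectation_mono[OF batch(2)]) simp
      then show ?thesis unfolding history_expectation_affine[OF batch(2)] by (simp add: history_expectation_def)
    qed
    ultimately have "real T * c \<le> \<Delta>" by (simp add: \<Delta>_def)
    moreover have "R * c < real T * c" using T c by simp
    moreover have "R * c \<ge> \<Delta>"
    proof -
      \<comment> \<open>\<open>c\<close> equals \<open>\<epsilon>\<^sup>2 * u\<^sup>2 / (8 * L *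
        (u\<^sup>2 + sigma2))\<close>, so \<open>step_const = 32\<close> leaves the factor 4. The
        quotient is at least 1 because \<open>\<epsilon> \<le> u\<close>.\<close>
      have "R * c = \<Delta> * (4 * (u\<^sup>2 * (\<epsilon>\<^sup>2 + sigma2)) / (\<epsilon>\<^sup>2 * (u\<^sup>2 + sigma2)))"
        using L \<epsilon> us unfolding R_def c_def \<alpha>_def step_const_def
        by (simp add: divide_simps power2_eq_square power4_eq_xxxx) (simp add: algebra_simps)
      moreover have "4 * (u\<^sup>2 * (\<epsilon>\<^sup>2 + sigma2)) / (\<epsilon>\<^sup>2 * (u\<^sup>2 + sigma2)) \<ge> 1"
      proof -
        have "\<epsilon>\<^sup>2 \<le> u\<^sup>2" using u \<epsilon> by (simp add: power_mono)
        then have "\<epsilon>\<^sup>2 * sigma2 \<le> u\<^sup>2 * sigma2" using \<sigma> by (intro mult_right_mono)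
        then have "\<epsilon>\<^sup>2 * (u\<^sup>2 + sigma2) \<le> 1 * (u\<^sup>2 * (\<epsilon>\<^sup>2 + sigma2))" by (simp add: algebra_simps)
        also have "\<dots> \<le> 4 * (u\<^sup>2 * (\<epsilon>\<^sup>2 + sigma2))" using \<sigma> by (intro mult_right_mono) auto
        finally show ?thesis using us \<epsilon> by simp
      qed
      ultimately show ?thesis using \<Delta> by (metis mult.right_neutral mult_left_mono)
    qed
    ultimately show False by linarith
  qed
  moreover have "\<alpha> / L > 0" using \<alpha> L by simp
  ultimately show ?thesis unfolding R_def x_def u_def by (metis add.commute)
qed

section \<open>Convergence of FO-B-MAML\<close>

text \<open>\<open>eta\<close> and \<open>t\<close> are chosen inside the quantifiers over
  \<open>\<delta>\<close>, \<open>nu\<close> and \<open>sol\<close>: the step size depends on the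
  bias bound, and \<open>t\<close> on the run itself.\<close>

theorem theorem2:
  fixes M B :: nat
    and f fh :: "nat \<Rightarrow> real ^ 'n \<Rightarrow> real"
    and lam mu L0 L1 Lh1 Lh2 zeta Lsm Fstar c1 c2 :: real
    and \<theta>0 :: "real ^ 'n"
  defines "F \<equiv> meta_obj M f fh lam"
    and "\<Delta> \<equiv> meta_obj M f fh lam \<theta>0 - Fstar"
    and "sigma2 \<equiv> (real M - real B) / (real M * real B) * zeta\<^sup>2"
  assumes batch_size: "1 \<le> B" "B \<le> M"
    and lam_pos: "lam > 0" and mu_pos: "mu > 0"
    and fh_diff: "\<And>i. i < M \<Longrightarrow> fh i differentiable_on UNIV"
    and fh_diff2: "\<And>i. i < M \<Longrightarrow> grad (fh i) differentiable_on UNIV"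
    and fh_grad: "\<And>i. i < M \<Longrightarrow> Lh1-lipschitz_on UNIV (grad (fh i))"
    and fh_hess: "\<And>i. i < M \<Longrightarrow> Lh2-lipschitz_on UNIV (fderiv (grad (fh i)))"
    and f_diff: "\<And>i. i < M \<Longrightarrow> f i differentiable_on UNIV"
    and f_lip: "\<And>i. i < M \<Longrightarrow> L0-lipschitz_on UNIV (f i)"
    and f_grad: "\<And>i. i < M \<Longrightarrow> L1-lipschitz_on UNIV (grad (f i))"
    and inner_convex: "\<And>i. i < M \<Longrightarrow> strongly_convex mu (\<lambda>\<phi>. fh i \<phi> + lam / 2 * (norm \<phi>)\<^sup>2)"
    and similarity:
      "\<And>\<theta>. 1 / real M * (\<Sum>i<M. (norm (grad (task_obj (f i) (fh i) lam) \<theta> - grad F \<theta>))\<^sup>2)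
             \<le> zeta\<^sup>2"
    and Lsm_pos: "Lsm > 0"
    and F_smooth: "\<And>\<theta> \<theta>'. norm (grad F \<theta> - grad F \<theta>') \<le> Lsm * norm (\<theta> - \<theta>')"
    and Fstar: "Fstar \<in> range F" "\<And>\<theta>. Fstar \<le> F \<theta>"
    and c1_pos: "c1 > 0" and c2_pos: "c2 > 0"
  shows
    "(\<forall>\<^sub>F \<epsilon> in at_right 0. \<forall>\<delta> nu sol.
        0 < \<delta> \<longrightarrow> c1 * sqrt \<delta> \<le> nu \<longrightarrow> nu \<le> c2 * sqrt \<delta> \<longrightarrow> nu * L1 < mu \<longrightarrow>
        inner_accurate M f fh lam \<delta> {nu, 0} sol \<longrightarrow>
        (\<exists>eta>0. \<exists>t::nat.
           real t \<le> step_const * (Lsm * \<Delta> / \<epsilon>\<^sup>2 + Lsm * \<Delta> * sigma2 / \<epsilon> ^ 4) \<and>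
           expected_grad_norm M f fh lam (forward_est lam nu) sol B eta \<theta>0 t
             \<le> \<epsilon> + forward_const mu L0 L1 Lh2 c1 c2 * (lam * sqrt \<delta>)))
     \<and>
     (\<forall>L2 Lh3.
        (\<forall>i<M.
           fderiv (grad (fh i)) differentiable_on UNIV \<and>
           fderiv (fderiv (grad (fh i))) differentiable_on UNIV \<and>
           continuous_on UNIV (fderiv (fderiv (fderiv (grad (fh i))))) \<and>
           Lh3-lipschitz_on UNIV (fderiv (fderiv (grad (fh i)))) \<and>
           grad (f i) differentiable_on UNIV \<and>
           fderiv (grad (f i)) differentiable_on UNIV \<and>
           continuous_on UNIV (fderiv (fderiv (grad (f i)))) \<and>
           L2-lipschitz_on UNIV (fderiv (grad (f i)))) \<longrightarrow>
        (\<forall>\<^sub>F \<epsilon> in at_right 0. \<forall>\<delta> nu sol.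
           0 < \<delta> \<longrightarrow> c1 * \<delta> powr (1/3) \<le> nu \<longrightarrow> nu \<le> c2 * \<delta> powr (1/3) \<longrightarrow> nu * L1 < mu \<longrightarrow>
           inner_accurate M f fh lam \<delta> {nu, - nu} sol \<longrightarrow>
           (\<exists>eta>0. \<exists>t::nat.
              real t \<le> step_const * (Lsm * \<Delta> / \<epsilon>\<^sup>2 + Lsm * \<Delta> * sigma2 / \<epsilon> ^ 4) \<and>
              expected_grad_norm M f fh lam (symmetric_est lam nu) sol B eta \<theta>0 t
                \<le> \<epsilon> + symmetric_const mu L0 L1 L2 Lh2 Lh3 c1 c2 * (lam * \<delta> powr (2/3)))))"
proof -
  have task: "task (f i) (fh i) lam mu L0 L1 Lh2" if "i < M" for i
    using that lam_pos mu_pos fh_diff fh_diff2 fh_hess f_diff f_lip f_grad inner_convex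
    by (simp add: task_def)
  have M: "0 < M" using batch_size by simp
  have L_nonneg: "L0 \<ge> 0" "L1 \<ge> 0" "Lh2 \<ge> 0"
    using f_lip[OF M] f_grad[OF M] fh_hess[OF M] lipschitz_on_nonneg by blast+
  define v where "v i \<theta> = grad (task_obj (f i) (fh i) lam) \<theta>" for i \<theta>
  have v_GDERIV: "GDERIV (task_obj (f i) (fh i) lam) \<theta> :> v i \<theta>" if "i < M" for i \<theta>
    unfolding v_def using task.grad_task_obj_eq[OF task[OF that]] by metis
  have F_GDERIV: "GDERIV F \<theta> :> (1 / real M) *\<^sub>R (\<Sum>i<M. v i \<theta>)" for \<theta>
    unfolding F_def meta_obj_def
    by (rule GDERIV_cmult, rule GDERIV_sum) (use v_GDERIV in auto)
  then have grad_F: "grad F \<theta> = (1 / real M) *\<^sub>R (\<Sum>i<M. v i \<theta>)" for \<theta>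
    by (rule grad_eqI)
  have sgd: "\<exists>eta>0. \<exists>t::nat.
      real t \<le> step_const * (Lsm * \<Delta> / \<epsilon>\<^sup>2 + Lsm * \<Delta> * sigma2 / \<epsilon> ^ 4)
      \<and> expected_grad_norm M f fh lam est sol B eta \<theta>0 t \<le> \<epsilon> + b"
    if "b \<ge> 0" "\<epsilon> > 0" "\<And>h i \<theta>. i < M \<Longrightarrow> norm (est (\<lambda>nu. sol h i nu \<theta>) - v i \<theta>) \<le> b"
    for est and sol :: "nat set list \<Rightarrow> nat \<Rightarrow> real \<Rightarrow> real ^ 'n \<Rightarrow> real ^ 'n" and b \<epsilon> :: real
    using biased_sgd_convergence[where F = F and G = "grad F" and v = v and est = est and sol = sol
        and b = b and \<epsilon> = \<epsilon> and L = Lsm and Fstar = Fstar and zeta = zeta and start = \<theta>0,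
        OF batch_size Lsm_pos that(1,2) _ F_smooth Fstar(2) grad_F _ that(3)]
      F_GDERIV similarity
    unfolding expected_grad_norm_def history_expectation_def \<Delta>_def sigma2_def F_def[symmetric] v_def[symmetric]
    by (simp add: grad_F)
  define T where "T = taylor_const mu L0 L1 Lh2"
  have T: "T \<ge> 0" unfolding T_def taylor_const_def using L_nonneg mu_pos by simp
  show ?thesis
  proof (intro conjI allI impI)
    show "\<forall>\<^sub>F \<epsilon> in at_right 0. \<forall>\<delta> nu sol.
        0 < \<delta> \<longrightarrow> c1 * sqrt \<delta> \<le> nu \<longrightarrow> nu \<le> c2 * sqrt \<delta> \<longrightarrow> nu * L1 < mu \<longrightarrow>
        inner_accurate M f fh lam \<delta> {nu, 0} sol \<longrightarrow>
        (\<exists>eta>0. \<exists>t::nat.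
           real t \<le> step_const * (Lsm * \<Delta> / \<epsilon>\<^sup>2 + Lsm * \<Delta> * sigma2 / \<epsilon> ^ 4) \<and>
           expected_grad_norm M f fh lam (forward_est lam nu) sol B eta \<theta>0 t
             \<le> \<epsilon> + forward_const mu L0 L1 Lh2 c1 c2 * (lam * sqrt \<delta>))"
    \<comment> \<open>The argument works at every positive \<epsilon>, so positivity alone
      discharges the filter.\<close>
    proof (rule eventually_mono[OF eventually_at_right_less], intro allI impI)
      fix \<epsilon> \<delta> nu :: real and sol :: "nat set list \<Rightarrow> nat \<Rightarrow> real \<Rightarrow> real ^ 'n \<Rightarrow> real ^ 'n"
      assume \<epsilon>: "0 < \<epsilon>" and \<delta>: "0 < \<delta>" and nu: "c1 * sqrt \<delta> \<le> nu" "nu \<le> c2 * sqrt \<delta>"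
        and acc: "inner_accurate M f fh lam \<delta> {nu, 0} sol"
      have nu0: "nu > 0" using nu(1) c1_pos \<delta> by (smt (verit) mult_pos_pos real_sqrt_gt_zero)
      \<comment> \<open>The lower bound on \<open>nu\<close> controls the amplified solver error and
        the upper bound the expansion error, hence \<open>2 / c1\<close> and the factor
        \<open>c2\<close> in \<open>forward_const\<close>.\<close>
      have bias: "lam * (2 * \<delta> / nu + nu * T) \<le> forward_const mu L0 L1 Lh2 c1 c2 * (lam * sqrt \<delta>)"
      proof -
        have "c1 * \<delta> \<le> nu * sqrt \<delta>"
          using mult_right_mono[OF nu(1), of "sqrt \<delta>"] \<delta> by (simp add: mult.assoc)
        then have "2 * \<delta> / nu \<le> 2 / c1 * sqrt \<delta>" using nu0 c1_pos by (simp add: field_simps)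
        moreover have "nu * T \<le> c2 * sqrt \<delta> * T" using nu(2) T by (rule mult_right_mono)
        ultimately have "2 * \<delta> / nu + nu * T \<le> forward_const mu L0 L1 Lh2 c1 c2 * sqrt \<delta>"
          by (simp add: forward_const_def T_def algebra_simps)
        from mult_left_mono[OF this, of lam] show ?thesis using lam_pos by (simp add: mult_ac)
      qed
      show "\<exists>eta>0. \<exists>t::nat.
           real t \<le> step_const * (Lsm * \<Delta> / \<epsilon>\<^sup>2 + Lsm * \<Delta> * sigma2 / \<epsilon> ^ 4) \<and>
           expected_grad_norm M f fh lam (forward_est lam nu) sol B eta \<theta>0 t
             \<le> \<epsilon> + forward_const mu L0 L1 Lh2 c1 c2 * (lam * sqrt \<delta>)"
      proof (rule sgd)
        show "0 \<le> forward_const mu L0 L1 Lh2 c1 c2 * (lam * sqrt \<delta>)"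
          using T lam_pos c1_pos c2_pos \<delta> by (simp add: forward_const_def T_def)
        fix h i \<theta> assume i: "i < M"
        obtain w where "task.hess (fh i) lam (phi_star (f i) (fh i) lam 0 \<theta>) w
            = grad (f i) (phi_star (f i) (fh i) lam 0 \<theta>)" "v i \<theta> = lam *\<^sub>R w"
          unfolding v_def using task.grad_task_obj_eq[OF task[OF i]] by metis
        with task.forward_est_error[OF task[OF i] this(1) nu0, of "\<lambda>nu. sol h i nu \<theta>" \<delta>] acc i bias
        show "norm (forward_est lam nu (\<lambda>nu. sol h i nu \<theta>) - v i \<theta>)
            \<le> forward_const mu L0 L1 Lh2 c1 c2 * (lam * sqrt \<delta>)"
          by (simp add: inner_accurate_def T_def)
      qed (rule \<epsilon>)
    qed
  next
    fix L2 Lh3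
    assume smooth: "\<forall>i<M.
           fderiv (grad (fh i)) differentiable_on UNIV \<and>
           fderiv (fderiv (grad (fh i))) differentiable_on UNIV \<and>
           continuous_on UNIV (fderiv (fderiv (fderiv (grad (fh i))))) \<and>
           Lh3-lipschitz_on UNIV (fderiv (fderiv (grad (fh i)))) \<and>
           grad (f i) differentiable_on UNIV \<and>
           fderiv (grad (f i)) differentiable_on UNIV \<and>
           continuous_on UNIV (fderiv (fderiv (grad (f i)))) \<and>
           L2-lipschitz_on UNIV (fderiv (grad (f i)))"
    then have L23: "L2 \<ge> 0" "Lh3 \<ge> 0" using M lipschitz_on_nonneg by blast+
    define C where "C = T * (L1 + Lh2 * L0 / mu) + Lh3 * L0 ^ 3 / (6 * mu ^ 3) + L2 * L0\<^sup>2 / (2 * mu\<^sup>2)"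
    have C: "C \<ge> 0" unfolding C_def using T L_nonneg L23 mu_pos by simp
    show "\<forall>\<^sub>F \<epsilon> in at_right 0. \<forall>\<delta> nu sol.
           0 < \<delta> \<longrightarrow> c1 * \<delta> powr (1/3) \<le> nu \<longrightarrow> nu \<le> c2 * \<delta> powr (1/3) \<longrightarrow> nu * L1 < mu \<longrightarrow>
           inner_accurate M f fh lam \<delta> {nu, - nu} sol \<longrightarrow>
           (\<exists>eta>0. \<exists>t::nat.
              real t \<le> step_const * (Lsm * \<Delta> / \<epsilon>\<^sup>2 + Lsm * \<Delta> * sigma2 / \<epsilon> ^ 4) \<and>
              expected_grad_norm M f fh lam (symmetric_est lam nu) sol B eta \<theta>0 t
                \<le> \<epsilon> + symmetric_const mu L0 L1 L2 Lh2 Lh3 c1 c2 * (lam * \<delta> powr (2/3)))"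
    proof (rule eventually_mono[OF eventually_at_right_less], intro allI impI)
      fix \<epsilon> \<delta> nu :: real and sol :: "nat set list \<Rightarrow> nat \<Rightarrow> real \<Rightarrow> real ^ 'n \<Rightarrow> real ^ 'n"
      assume \<epsilon>: "0 < \<epsilon>" and \<delta>: "0 < \<delta>"
        and nu: "c1 * \<delta> powr (1/3) \<le> nu" "nu \<le> c2 * \<delta> powr (1/3)"
        and acc: "inner_accurate M f fh lam \<delta> {nu, - nu} sol"
      have nu0: "nu > 0" using nu(1) c1_pos \<delta> by (smt (verit) mult_pos_pos powr_gt_zero)
      have bias: "lam * (\<delta> / nu + nu\<^sup>2 / mu * C)
          \<le> symmetric_const mu L0 L1 L2 Lh2 Lh3 c1 c2 * (lam * \<delta> powr (2/3))"
      proof -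
        \<comment> \<open>The exponents 1/3 and 2/3 add up to 1, so the lower bound on
          \<open>nu\<close> makes \<open>\<delta> / nu\<close> of order
          \<open>\<delta> powr (2/3)\<close>; squaring the upper bound gives the same power.\<close>
        have pw: "\<delta> powr (1/3) * \<delta> powr (2/3) = \<delta>" "(\<delta> powr (1/3))\<^sup>2 = \<delta> powr (2/3)"
          using \<delta> by (simp_all add: powr_add[symmetric] power2_eq_square)
        have "c1 * \<delta> \<le> nu * \<delta> powr (2/3)"
          using mult_right_mono[OF nu(1), of "\<delta> powr (2/3)"] by (simp add: mult.assoc pw)
        then have 1: "\<delta> / nu \<le> \<delta> powr (2/3) / c1" using nu0 c1_pos by (simp add: field_simps)
        have "nu\<^sup>2 \<le> (c2 * \<delta> powr (1/3))\<^sup>2" using nu(2) nu0 by (intro power_mono) auto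
        then have "nu\<^sup>2 \<le> c2\<^sup>2 * \<delta> powr (2/3)" by (simp add: power_mult_distrib pw)
        then have "nu\<^sup>2 / mu * C \<le> c2\<^sup>2 * \<delta> powr (2/3) / mu * C"
          using mu_pos C by (intro mult_right_mono divide_right_mono) auto
        with 1 have "\<delta> / nu + nu\<^sup>2 / mu * C
            \<le> symmetric_const mu L0 L1 L2 Lh2 Lh3 c1 c2 * \<delta> powr (2/3)"
          unfolding symmetric_const_def T_def[symmetric] C_def[symmetric] by (simp add: algebra_simps)
        from mult_left_mono[OF this, of lam] show ?thesis using lam_pos by (simp add: mult_ac)
      qed
      show "\<exists>eta>0. \<exists>t::nat.
              real t \<le> step_const * (Lsm * \<Delta> / \<epsilon>\<^sup>2 + Lsm * \<Delta> * sigma2 / \<epsilon> ^ 4) \<and>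
              expected_grad_norm M f fh lam (symmetric_est lam nu) sol B eta \<theta>0 t
                \<le> \<epsilon> + symmetric_const mu L0 L1 L2 Lh2 Lh3 c1 c2 * (lam * \<delta> powr (2/3))"
      proof (rule sgd)
        show "0 \<le> symmetric_const mu L0 L1 L2 Lh2 Lh3 c1 c2 * (lam * \<delta> powr (2/3))"
          unfolding symmetric_const_def T_def[symmetric] C_def[symmetric]
          using C lam_pos mu_pos c1_pos by simp
        fix h i \<theta> assume i: "i < M"
        obtain w where w: "task.hess (fh i) lam (phi_star (f i) (fh i) lam 0 \<theta>) w
            = grad (f i) (phi_star (f i) (fh i) lam 0 \<theta>)" "v i \<theta> = lam *\<^sub>R w"
          unfolding v_def using task.grad_task_obj_eq[OF task[OF i]] by metis
        have "norm (symmetric_est lam nu (\<lambda>nu. sol h i nu \<theta>) - lam *\<^sub>R w) \<le> lam * (\<delta> / nu + nu\<^sup>2 / mu * C)"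
          unfolding C_def T_def
          by (rule task.symmetric_est_error[OF task[OF i] _ _ _ _ w(1) nu0])
            (use smooth acc i in \<open>auto simp: inner_accurate_def\<close>)
        then show "norm (symmetric_est lam nu (\<lambda>nu. sol h i nu \<theta>) - v i \<theta>)
            \<le> symmetric_const mu L0 L1 L2 Lh2 Lh3 c1 c2 * (lam * \<delta> powr (2/3))"
          using bias w(2) by simp
      qed (rule \<epsilon>)
    qed
  qed
qed

end
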